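(* Let $a_0\in(0,+\infty)$ and $\beta\in\left(0,\frac{\sqrt6}{6}\right)$. Then there exists a unique globally singularity-free, homogeneous and isotropic FLRW solution $(g,\phi)\in C^2((-\infty,+\infty))$, where $g(t)=-dt^2+a^2(t)\left(dr^2+r^2(d\theta^2+\sin^2\theta\,d\varphi^2)\right)$ (that is, a unique pair $a:\mathbb{R}\to(0,\infty)$, $\phi:\mathbb{R}\to\mathbb{R}$ of $C^2$ functions) which, with $H=\dot a/a$, solves for all $t\in\mathbb{R}$ the EdGB field equations $$3H^2-3e^\phi\dot\phi H^3=\frac{\dot\phi^2}{2},$$ $$2\dot H+3H^2=-\frac{\dot\phi^2}{2}+2e^\phi\dot\phi H(H^2+\dot H)+e^\phi H^2(\dot\phi^2+\ddot\phi),$$ $$\ddot\phi=-3H\dot\phi-3e^\phi H^2(H^2+\dot H),$$ with initial data $a(0)=a_0$, $H(0)=\beta$, $\phi(0)=0$ and satisfying $\dot\phi(0)<0$. Moreover, setting $$\gamma=\frac{3\beta^3+\sqrt{9\beta^6+12}}{2},\quad \theta=\frac{2\left(9\beta^6+\sqrt{9\beta^6+12}\,\beta^3\right)}{\left(\sqrt{9\beta^6+12}+3\beta^3\right)^2},\quad m=\frac{107\sqrt{9\beta^6+12}+309\beta^3}{60\beta^3},$$ the following estimates hold. (1) For $t\in(-\infty,0)$, $$H(t)<\min\left\{\left(e^{6\gamma t}\left(\frac1{\beta^2}-\frac{4\beta}{5\gamma}+\frac{2\theta}{15\gamma^2}\right)-\frac{2(-6\beta\gamma+\theta+6\gamma\theta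 t)}{15\gamma^2}\right)^{-\frac12},\ \frac{\gamma}{-3\beta^3t+1}\right\},$$ $$H(t)>\left[\beta^{-1/4}-\frac{\beta^{-1/4}}{4(m+1)}\left(1-(-3\beta^3t+1)^{m+1}\right)\right]^{-4}>0,$$ $$\ln(-3\beta^3t+1)^2<\phi(t)<\frac{\sqrt6\,\gamma}{3\beta^3}\ln(-3\beta^3t+1)+\frac{2\beta^3}{4\gamma+\beta^3}\left[(-3\beta^3t+1)^{\frac{4\gamma+\beta^3}{\beta^3}}-1\right].$$ (2) For $t\in(0,+\infty)$, $$\frac{1}{5t+\frac1\beta}<H(t)<\frac{1}{\frac12t+\frac1\beta},$$ $$-(12\beta^2+2\sqrt6)\ln\left(\frac12\beta t+1\right)<\phi(t)<-\ln\left(1+\frac35\left(\beta^2-\frac{1}{(5t+\frac1\beta)^2}\right)\right).$$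
   Context: Dots denote derivatives with respect to $t$. $a$ is the scale factor, $H=\dot a/a$ the Hubble parameter (so $a(t)=a_0e^{\int_0^tH(s)\,ds}$), and $\phi$ a scalar (dilaton-like) field depending only on $t$. The equations are the Einstein-dilaton-Gauss-Bonnet (EdGB) field equations with coupling function $f(\phi)=e^\phi$ and zero potential, reduced to the spatially flat FLRW metric. "Globally singularity-free" means that the solution is defined and $C^2$ for all $t\in(-\infty,+\infty)$. Here $\ln(x)^2$ denotes $\ln(x^2)$. *)

theory Defs
  imports "HOL-Analysis.Analysis"
begin

definition C2_real :: "(real \<Rightarrow> real) \<Rightarrow> bool" where
  "C2_real f \<longleftrightarrow> f C1_differentiable_on UNIV \<and> deriv f C1_differentiable_on UNIV"

definition hubble :: "(real \<Rightarrow> real) \<Rightarrow> real \<Rightarrow> real" where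
  "hubble a t = deriv a t / a t"

text \<open>The Einstein-dilaton-Gauss-Bonnet field equations at time \<open>t\<close> with coupling
  \<open>f(\<phi>) = exp \<phi>\<close> and zero potential, reduced to the flat FLRW metric
  \<open>-dt^2 + a(t)^2 (dr^2 + r^2 (d\<theta>^2 + sin^2 \<theta> d\<psi>^2))\<close>: the constraint, the equation
  for the derivative of \<open>H\<close>, and the scalar equation.\<close>

definition edgb_flrw_equations :: "(real \<Rightarrow> real) \<Rightarrow> (real \<Rightarrow> real) \<Rightarrow> real \<Rightarrow> bool" where
  "edgb_flrw_equations a \<phi> t \<longleftrightarrow>
    (let H = hubble a t; H' = deriv (hubble a) t;
         \<phi>' = deriv \<phi> t; \<phi>'' = deriv (deriv \<phi>) t; E = exp (\<phi> t)
     in 3 * H^2 - 3 * E * \<phi>' * H^3 = \<phi>'^2 / 2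
      \<and> 2 * H' + 3 * H^2 = - (\<phi>'^2 / 2) + 2 * E * \<phi>' * H * (H^2 + H') + E * H^2 * (\<phi>'^2 + \<phi>'')
      \<and> \<phi>'' = - 3 * H * \<phi>' - 3 * E * H^2 * (H^2 + H'))"

text \<open>A globally singularity-free solution (\<open>C^2\<close> on the whole time line) with the
  prescribed data at \<open>t = 0\<close>; the pair \<open>(a, \<phi>)\<close> stands for \<open>(g, \<phi>)\<close>, the
  metric being determined by its positive scale factor. The sign condition on the derivative
  of \<open>\<phi>\<close> selects one root of the constraint, which is quadratic in that derivative.\<close>

definition global_edgb_solution ::
    "real \<Rightarrow> real \<Rightarrow> (real \<Rightarrow> real) \<Rightarrow> (real \<Rightarrow> real) \<Rightarrow> bool" where
  "global_edgb_solution a0 \<beta> a \<phi> \<longleftrightarrow>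
     C2_real a \<and> C2_real \<phi> \<and> (\<forall>t. 0 < a t) \<and>
     (\<forall>t. edgb_flrw_equations a \<phi> t) \<and>
     a 0 = a0 \<and> hubble a 0 = \<beta> \<and> \<phi> 0 = 0 \<and> deriv \<phi> 0 < 0"

end

(*
  Put x = e^phi H^2 and w = - phi' / H. The constraint is quadratic in w and gives
  x = (w^2 - 6) / (6 w) with w > sqrt 6, so the other two equations become an autonomous system
  H' = H^2 h(w), w' = H r(w) with rational h and r < 0 (x, h and r are coupling, hub_rate and
  ratio_rate below).

  Existence and uniqueness: H is a function Hs of w alone, hence w' = Hs(w) r(w) is solved by
  quadrature. The time integral diverges at both ends of (sqrt 6, infinity) because w Hs(w) is
  bounded, so the solution is global; any solution follows this curve as long as H > 0, and by
  continuity H can never reach 0.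

  Estimates: each of them compares logarithmic derivatives of monomials in e^phi and H, which are
  H times a rational function of w, and so reduces to the sign of a polynomial on (sqrt 6, infinity).
*)

theory Submission
  imports Defs
begin

section \<open>Reduction to an autonomous system\<close>

text \<open>The reduction rests on homogeneity: with \<phi>' = - w H, exp \<phi> = x / H^2, and H',
  \<phi>'' measured in units of H^2, every term of the field equations is a multiple of H^2. The
  last two equations are then linear in H' and \<phi>'', with positive determinant 2 + 2 x w + 3
  x^2. Two obstacles shape the rest. First, w makes sense only where H is nonzero, and H > 0 is
  given at 0 alone; so uniqueness is proved on intervals where H > 0 and then extended. Second, h
  changes sign, so for negative times a bound on H has to be bootstrapped: z = exp \<phi> H^3 obeys
  z' < 3 z^2, which bounds z below by \<beta>^3 / u with u = 1 - 3 \<beta>^3 t; this yields \<phi> >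
  ln (u^2), then H u < sqrt 3, and the remaining backward bounds rest on that. For positive times
  \<beta> < sqrt 6 / 6 keeps w below 3, where h lies between - 5 and - 1/2.\<close>

definition hub_den :: "real \<Rightarrow> real" where
  "hub_den w = 5 * w^4 - 12 * w^2 + 36"

definition hub_num :: "real \<Rightarrow> real" where
  "hub_num w = 2 * w^5 - 5 * w^4 - 12 * w^3 - 36 * w^2 - 36"

text \<open>The value of H' / H^2 after elimination of \<phi>'' from the last two field equations;
  \<open>hub_den w\<close> is \<open>12 * w^2\<close> times the determinant of that
  elimination.\<close>

definition hub_rate :: "real \<Rightarrow> real" where
  "hub_rate w = hub_num w / hub_den w"

definition coupling :: "real \<Rightarrow> real" where
  "coupling w = (w^2 - 6) / (6 * w)"

text \<open>The factor \<open>w^2 - 6\<close> vanishes at the left end of the range of w, which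
  makes the time integral diverge there.\<close>

definition ratio_rate :: "real \<Rightarrow> real" where
  "ratio_rate w = - (w * (w^2 - 6) * (w^3 + 10 * w^2 + 6 * w + 12)) / hub_den w"

lemma hub_den_pos: "hub_den w > 0"
proof -
  have "hub_den w = 4 * (w^2)^2 + (w^2 - 6)^2"
    by (simp add: hub_den_def power2_eq_square power4_eq_xxxx algebra_simps)
  moreover have "4 * (w^2)^2 + (w^2 - 6)^2 > 0"
    by (cases "w = 0") (auto intro!: add_pos_nonneg)
  ultimately show ?thesis by simp
qed

lemma sqrt6_less_iff: "sqrt 6 < (w::real) \<longleftrightarrow> 0 < w \<and> 6 < w^2"
  by (metis less_trans real_sqrt_gt_zero real_sqrt_less_iff real_sqrt_abs abs_of_pos zero_less_numeral)

lemma coupling_mult: "w \<noteq> 0 \<Longrightarrow> 6 * (coupling w * w) = w^2 - 6"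
  by (simp add: coupling_def)

text \<open>The scalar equation in terms of w: r = - \<phi>'' / H^2 - w h with \<phi>'' / H^2 = 3 w
  - 3 x (1 + h), and the factor 2 w lets 6 x w = w^2 - 6 remove x.\<close>

lemma ratio_rate_eq:
  "2 * w * ratio_rate w = - (5 * w^2 + 6) - (w^2 + 6) * hub_rate w"
proof -
  have "2 * w * (- (w * (w^2 - 6) * (w^3 + 10 * w^2 + 6 * w + 12)))
      = - (5 * w^2 + 6) * hub_den w - (w^2 + 6) * hub_num w"
    by (simp add: hub_den_def hub_num_def algebra_simps eval_nat_numeral)
  then show ?thesis
    using hub_den_pos[of w] by (simp add: hub_rate_def ratio_rate_def field_simps)
qed

text \<open>Substituting the scalar equation into the equation for H' leaves this linear equation
  for h. After multiplication by \<open>12 * w^2\<close>, x occurs only in q = 6 x w, which the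
  constraint makes a polynomial in w.\<close>

lemma hub_rate_eq:
  assumes w: "w \<noteq> 0"
  defines "x \<equiv> coupling w"
  shows "0 < 2 + 2 * x * w + 3 * x^2"
    and "hub_rate w * (2 + 2 * x * w + 3 * x^2) = - 3 - w^2 / 2 + x * w + x * w^2 - 3 * x^2"
proof -
  define q where "q = 6 * (x * w)"
  have q: "q = w^2 - 6" using coupling_mult[OF w] by (simp add: q_def x_def)
  have "12 * w^2 * (2 + 2 * x * w + 3 * x^2) = 24 * w^2 + 4 * w^2 * q + q^2"
    by (simp add: q_def algebra_simps power2_eq_square)
  also have "\<dots> = hub_den w"
    unfolding q by (simp add: hub_den_def algebra_simps eval_nat_numeral)
  finally have D: "2 + 2 * x * w + 3 * x^2 = hub_den w / (12 * w^2)"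
    using w by (simp add: field_simps)
  then show "0 < 2 + 2 * x * w + 3 * x^2"
    using hub_den_pos[of w] w by simp
  have "12 * w^2 * (- 3 - w^2 / 2 + x * w + x * w^2 - 3 * x^2)
      = - 36 * w^2 - 6 * w^4 + 2 * w^2 * q + 2 * w^3 * q - q^2"
    by (simp add: q_def algebra_simps eval_nat_numeral)
  also have "\<dots> = hub_num w"
    unfolding q by (simp add: hub_num_def algebra_simps eval_nat_numeral)
  finally have N: "- 3 - w^2 / 2 + x * w + x * w^2 - 3 * x^2 = hub_num w / (12 * w^2)"
    using w by (simp add: field_simps)
  show "hub_rate w * (2 + 2 * x * w + 3 * x^2) = - 3 - w^2 / 2 + x * w + x * w^2 - 3 * x^2"
    unfolding D N using hub_den_pos[of w] by (simp add: hub_rate_def)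
qed

text \<open>Once p, E, H1 and p1 are expressed through w, x, \<eta> and \<pi>', each equation is H^2
  times an equation free of H. The sign of p makes w positive, and then 6 x w = w^2 - 6 > 0 forces w
  > sqrt 6. The last conclusion concerns the quotient rule for \<open>- p / H\<close>.\<close>

lemma reduced_equations:
  fixes E H p H1 p1 :: real
  assumes "E > 0" "H > 0" "p < 0"
    and c: "3 * H^2 - 3 * E * p * H^3 = p^2 / 2"
    and e2: "2 * H1 + 3 * H^2 = - (p^2 / 2) + 2 * E * p * H * (H^2 + H1) + E * H^2 * (p^2 + p1)"
    and e3: "p1 = - 3 * H * p - 3 * E * H^2 * (H^2 + H1)"
  defines "w \<equiv> - p / H"
  shows "sqrt 6 < w" "E * H^2 = coupling w" "H1 = H^2 * hub_rate w"
    "- (p1 * H - p * H1) / H^2 = H * ratio_rate w"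
proof -
  define x \<eta> \<pi>' where "x = E * H^2" and "\<eta> = H1 / H^2" and "\<pi>' = p1 / H^2"
  have w: "w > 0" using assms by (simp add: w_def field_simps)
  have x: "x > 0" using assms by (simp add: x_def)
  have p: "p = - w * H" and E: "E = x / H^2" and H1: "H1 = \<eta> * H^2" and p1: "p1 = \<pi>' * H^2"
    using \<open>H > 0\<close> by (simp_all add: w_def x_def \<eta>_def \<pi>'_def)
  have "H^2 * (6 + 6 * x * w) = H^2 * w^2"
    using c \<open>H > 0\<close> unfolding p E by (simp add: field_simps power2_eq_square power3_eq_cube)
  then have c': "6 * x * w = w^2 - 6" using \<open>H > 0\<close> by simp
  have "6 < w^2" using c' mult_pos_pos[OF x w] by linarith
  with w show "sqrt 6 < w" by (simp add: sqrt6_less_iff)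
  have xw: "x = coupling w" using c' w by (simp add: coupling_def field_simps)
  then show "E * H^2 = coupling w" by (simp add: x_def)
  have "H^2 * (2 * \<eta> + 3) = H^2 * (- (w^2 / 2) - 2 * x * w * (1 + \<eta>) + x * (w^2 + \<pi>'))"
    using e2 \<open>H > 0\<close> unfolding p E H1 p1 by (simp add: field_simps power2_eq_square power3_eq_cube)
  then have e2': "2 * \<eta> + 3 = - (w^2 / 2) - 2 * x * w * (1 + \<eta>) + x * (w^2 + \<pi>')"
    using \<open>H > 0\<close> by simp
  have "H^2 * \<pi>' = H^2 * (3 * w - 3 * x * (1 + \<eta>))"
    using e3 \<open>H > 0\<close> unfolding p E H1 p1 by (simp add: field_simps power2_eq_square power3_eq_cube)
  then have e3': "\<pi>' = 3 * w - 3 * x * (1 + \<eta>)" using \<open>H > 0\<close> by simp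
  have "\<eta> * (2 + 2 * x * w + 3 * x^2) = - 3 - w^2 / 2 + x * w + x * w^2 - 3 * x^2"
    using e2' unfolding e3' by (simp add: algebra_simps power2_eq_square)
  also have "\<dots> = hub_rate w * (2 + 2 * x * w + 3 * x^2)"
    using hub_rate_eq(2)[of w] w by (simp add: xw)
  finally have \<eta>: "\<eta> = hub_rate w"
    using hub_rate_eq(1)[of w] w by (simp add: xw)
  then show "H1 = H^2 * hub_rate w" by (simp add: H1)
  have "2 * w * (- \<pi>' - w * \<eta>) = - 6 * w^2 + (6 * x * w) * (1 + \<eta>) - 2 * w^2 * \<eta>"
    by (simp add: e3' algebra_simps power2_eq_square)
  also have "\<dots> = 2 * w * ratio_rate w"
    unfolding c' ratio_rate_eq \<eta> by (simp add: algebra_simps)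
  finally have "- \<pi>' - w * \<eta> = ratio_rate w" using w by simp
  moreover have "- (p1 * H - p * H1) / H^2 = H * (- \<pi>' - w * \<eta>)"
    using \<open>H > 0\<close> unfolding p H1 p1 by (simp add: field_simps power2_eq_square)
  ultimately show "- (p1 * H - p * H1) / H^2 = H * ratio_rate w" by simp
qed

text \<open>Converse of the reduction: H1 and p1 are the derivatives of H and of - w H along the
  autonomous system.\<close>

lemma equations_of_reduced:
  fixes E H w :: real
  assumes "H > 0" "w > 0" and E: "E * H^2 = coupling w"
  defines "p \<equiv> - (w * H)" and "H1 \<equiv> H^2 * hub_rate w"
    and "p1 \<equiv> - (w * (H^2 * hub_rate w)) - H^2 * ratio_rate w"
  shows "3 * H^2 - 3 * E * p * H^3 = p^2 / 2"
    "2 * H1 + 3 * H^2 = - (p^2 / 2) + 2 * E * p * H * (H^2 + H1) + E * H^2 * (p^2 + p1)"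
    "p1 = - 3 * H * p - 3 * E * H^2 * (H^2 + H1)"
proof -
  define x \<eta> \<rho> where "x = coupling w" and "\<eta> = hub_rate w" and "\<rho> = ratio_rate w"
  have c': "6 * x * w = w^2 - 6" using coupling_mult[of w] \<open>w > 0\<close> by (simp add: x_def)
  have x: "E = x / H^2" using E \<open>H > 0\<close> by (simp add: x_def field_simps)
  have p1: "p1 = H^2 * (- (w * \<eta>) - \<rho>)" and H1: "H1 = H^2 * \<eta>"
    by (simp_all add: p1_def H1_def \<eta>_def \<rho>_def algebra_simps)
  have "H^2 * (6 + 6 * x * w) = H^2 * w^2" by (simp add: c')
  then show "3 * H^2 - 3 * E * p * H^3 = p^2 / 2"
    using \<open>H > 0\<close> unfolding p_def x by (simp add: field_simps power2_eq_square power3_eq_cube)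
  have "2 * w * (- (w * \<eta>) - \<rho>) = 6 * w^2 - (6 * x * w) * (1 + \<eta>)"
    using ratio_rate_eq[of w] unfolding c'
    by (simp add: \<eta>_def \<rho>_def algebra_simps power2_eq_square)
  also have "\<dots> = 2 * w * (3 * w - 3 * x * (1 + \<eta>))"
    by (simp add: algebra_simps power2_eq_square)
  finally have e3: "- (w * \<eta>) - \<rho> = 3 * w - 3 * x * (1 + \<eta>)"
    using \<open>w > 0\<close> by simp
  show "p1 = - 3 * H * p - 3 * E * H^2 * (H^2 + H1)"
    using \<open>H > 0\<close> unfolding p1 e3 H1 p_def x by (simp add: field_simps power2_eq_square)
  have "\<eta> * (2 + 2 * x * w + 3 * x^2) = - 3 - w^2 / 2 + x * w + x * w^2 - 3 * x^2"
    using hub_rate_eq(2)[of w] \<open>w > 0\<close> by (simp add: x_def \<eta>_def)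
  then have e2: "2 * \<eta> + 3 = - (w^2 / 2) - 2 * x * w * (1 + \<eta>) + x * (w^2 + (3 * w - 3 * x * (1 + \<eta>)))"
    by (simp add: algebra_simps power2_eq_square)
  have "2 * H1 + 3 * H^2 = H^2 * (2 * \<eta> + 3)" by (simp add: H1 algebra_simps)
  then show "2 * H1 + 3 * H^2 = - (p^2 / 2) + 2 * E * p * H * (H^2 + H1) + E * H^2 * (p^2 + p1)"
    using \<open>H > 0\<close> unfolding p1 e3 e2 H1 p_def x by (simp add: field_simps power2_eq_square)
qed

section \<open>Bounds for the rational right-hand sides\<close>

lemma hub_rate_less_iff: "hub_rate w < c \<longleftrightarrow> hub_num w < c * hub_den w"
  and less_hub_rate_iff: "c < hub_rate w \<longleftrightarrow> c * hub_den w < hub_num w"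
  using hub_den_pos[of w] by (simp_all add: hub_rate_def pos_divide_less_eq pos_less_divide_eq)

text \<open>The interval contains all values of w at nonnegative times. Each difference of
  \<open>hub_num\<close> and a multiple of \<open>hub_den\<close> is regrouped into products whose
  factors are positive on it.\<close>

lemma hub_rate_bounds_late:
  assumes "sqrt 6 < w" "w < 3"
  shows "- 5 < hub_rate w" "hub_rate w < - 1 / 2"
proof -
  have w: "w > 0" "w^2 > 6" using assms by (auto simp: sqrt6_less_iff)
  have "0 < 2 * w^3 * (w^2 - 6) + 20 * w^2 * (w^2 - 6) + 24 * w^2 + 144"
    using w by (intro add_pos_pos mult_pos_pos) auto
  then show "- 5 < hub_rate w"
    unfolding less_hub_rate_iff hub_num_def hub_den_def
    by (simp add: algebra_simps eval_nat_numeral)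
  have "w^2 < 9" using w assms power_strict_mono[of w 3 2] by simp
  then have "0 < 4 * w^3 * (9 - w^2) + 12 * w^2 * (7 - w) + 5 * w^4 + 36"
    using w assms by (intro add_pos_pos mult_pos_pos) auto
  then show "hub_rate w < - 1 / 2"
    unfolding hub_rate_less_iff hub_num_def hub_den_def
    by (simp add: algebra_simps eval_nat_numeral)
qed

text \<open>The first inequality says H' < 3 x H^2, the second (exp \<phi> H^3)' < 3 (exp \<phi>
  H^3)^2, the third (exp \<phi> H)' < - x.\<close>

lemma hub_rate_upper:
  assumes "sqrt 6 < w"
  shows "hub_rate w < 3 * coupling w" "3 * hub_rate w < w + 3 * coupling w" "hub_rate w < w - 1"
proof -
  have w: "w > 0" "w^2 > 6" using assms by (auto simp: sqrt6_less_iff)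
  have w2: "w > 2" using w power2_less_imp_less[of 2 w] by simp
  have 3: "3 * coupling w = (w^2 - 6) / (2 * w)"
    using w by (simp add: coupling_def field_simps)
  have "0 < w^4 * ((w^2 - 4) + 10 * (w - 2) + 6) + 72 * w^3 + 72 * w + 108 * (w^2 - 6) + 432"
    using w w2 by (intro add_pos_pos mult_pos_pos) auto
  then have "2 * w * hub_num w < (w^2 - 6) * hub_den w"
    by (simp add: hub_num_def hub_den_def algebra_simps eval_nat_numeral)
  then show "hub_rate w < 3 * coupling w"
    using w hub_den_pos[of w] unfolding 3 by (simp add: hub_rate_def field_simps)
  have "0 < 3 * w^6 + 30 * w^5 + 6 * w^4 + 216 * w^3 + 180 * (w^2 - 6) + 216 * w + 864"
    using w by (intro add_pos_pos mult_pos_pos) auto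
  then have "6 * w * hub_num w < (2 * w * w + (w^2 - 6)) * hub_den w"
    by (simp add: hub_num_def hub_den_def algebra_simps eval_nat_numeral)
  then have "hub_num w / hub_den w < (2 * w * w + (w^2 - 6)) / (6 * w)"
    using w hub_den_pos[of w] by (simp add: field_simps)
  moreover have "(2 * w * w + (w^2 - 6)) / (6 * w) = (w + 3 * coupling w) / 3"
    using w coupling_mult[of w] by (simp add: field_simps power2_eq_square)
  ultimately have "hub_rate w < (w + 3 * coupling w) / 3" by (simp only: hub_rate_def)
  then have "hub_rate w * 3 < w + 3 * coupling w"
    by (subst (asm) pos_less_divide_eq) auto
  then show "3 * hub_rate w < w + 3 * coupling w" by (subst mult.commute)
  have "0 < 3 * w^5 + 48 * w^2 + 36 * w"
    using w by (intro add_pos_pos mult_pos_pos) auto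
  then have "hub_num w < (w - 1) * hub_den w"
    by (simp add: hub_num_def hub_den_def algebra_simps eval_nat_numeral)
  then show "hub_rate w < w - 1"
    using hub_den_pos[of w] by (simp add: hub_rate_def field_simps)
qed

text \<open>These bound the logarithmic derivatives of H, exp \<phi> H^(11/4) and exp \<phi> H^3,
  each divided by H.\<close>

lemma hub_rate_lower:
  assumes "sqrt 6 < w"
  shows "- 3 + 12 / 5 * coupling w < hub_rate w"
    "- 107 / 10 + 3 / 5 * coupling w < 11 / 4 * hub_rate w - w"
    "- 12 < 3 * hub_rate w - w"
proof -
  have w: "w > 0" "w^2 > 6" using assms by (auto simp: sqrt6_less_iff)
  define q where "q = w^2 - 6"
  have q: "q > 0" "w^2 = q + 6" using w by (auto simp: q_def)
  \<comment> \<open>A rational just below sqrt 6; it has to exceed 17280 / 7056, the zero of the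
    summand \<open>7056 * w - 17280\<close> below.\<close>
  have "(244945 / 100000)^2 < w^2" using w(2) by (simp add: power2_eq_square)
  then have w24: "244945 / 100000 < w" using w(1) power2_less_imp_less less_imp_le by blast
  have "0 < (w^2 - 6) * (w * (50 * (w^2 - 6) + 240) + 24 * (w^2 - 6) + 72)"
    using w by (intro mult_pos_pos add_pos_pos) auto
  then have "((- 15 * w) + 2 * (w^2 - 6)) * hub_den w < 5 * w * hub_num w"
    by (simp add: hub_num_def hub_den_def algebra_simps eval_nat_numeral)
  then have "((- 15 * w) + 2 * (w^2 - 6)) / (5 * w) < hub_rate w"
    using w hub_den_pos[of w] by (simp add: hub_rate_def field_simps)
  moreover have "((- 15 * w) + 2 * (w^2 - 6)) / (5 * w) = - 3 + 12 / 5 * coupling w"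
    using w by (simp add: coupling_def field_simps)
  ultimately show "- 3 + 12 / 5 * coupling w < hub_rate w" by simp
  have "0 < q^2 * (795 * w - 336) + q * (4992 * w - 4968) + (7056 * w - 17280)"
    using q w24 by (intro add_pos_pos mult_pos_pos) auto
  also have "\<dots> = 795 * w^5 - 336 * w^4 - 4548 * w^3 - 936 * w^2 + 5724 * w + 432"
    by (simp add: q_def algebra_simps eval_nat_numeral)
  finally have "2 * (11 * w^2 - 107 * w - 6) * hub_den w < 55 * w * hub_num w"
    by (simp add: hub_num_def hub_den_def algebra_simps eval_nat_numeral)
  then have "(11 * w^2 - 107 * w - 6) / (10 * w) < 11 / 4 * hub_rate w"
    using w hub_den_pos[of w] by (simp add: hub_rate_def field_simps)
  moreover have "(11 * w^2 - 107 * w - 6) / (10 * w) = w - 107 / 10 + 3 / 5 * coupling w"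
    using w by (simp add: coupling_def field_simps power2_eq_square)
  ultimately show "- 107 / 10 + 3 / 5 * coupling w < 11 / 4 * hub_rate w - w" by simp
  \<comment> \<open>61/25 is slightly below sqrt 6. Once \<open>w^3 * (q + 45 * d)\<close> is split
    off, the remaining cubic is expanded about 61/25, where all its Taylor coefficients are
    positive.\<close>
  define d where "d = w - 61 / 25"
  have d: "d > 0" using w24 by (simp add: d_def)
  have "0 < w^3 * (q + 45 * d) + 459 / 5 * d^3 + 419976 / 1000 * d^2
      + 37386144 / 100000 * d + 694115712 / 10000000"
    using d w q by (intro add_pos_pos mult_pos_pos) auto
  also have "\<dots> = w^5 + 45 * w^4 - 24 * w^3 - 252 * w^2 - 36 * w + 324"
    by (simp add: d_def q_def field_simps eval_nat_numeral)
  finally have "0 < w^5 + 45 * w^4 - 24 * w^3 - 252 * w^2 - 36 * w + 324" .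
  then have "(w - 12) * hub_den w < 3 * hub_num w"
    by (simp add: hub_num_def hub_den_def algebra_simps eval_nat_numeral)
  then have "w - 12 < 3 * hub_rate w"
    using hub_den_pos[of w] by (simp add: hub_rate_def field_simps)
  then show "- 12 < 3 * hub_rate w - w" by simp
qed

lemma coupling_pos: "sqrt 6 < w \<Longrightarrow> 0 < coupling w"
  by (auto simp: sqrt6_less_iff coupling_def)

lemma ratio_rate_neg: "sqrt 6 < w \<Longrightarrow> ratio_rate w < 0"
  unfolding ratio_rate_def sqrt6_less_iff
  by (intro divide_neg_pos hub_den_pos) (simp add: add_pos_pos)

lemma coupling_strict_mono:
  assumes "0 < v" "v < w" shows "coupling v < coupling w"
proof -
  have "coupling u = u / 6 - inverse u" if "u > 0" for u
    using that by (simp add: coupling_def field_simps power2_eq_square)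
  moreover have "inverse w < inverse v" using assms by simp
  ultimately show ?thesis using assms by (smt (verit) divide_strict_right_mono)
qed

text \<open>6 x = w - 6 / w with 6 / w < sqrt 6. This trades - \<phi>' = w H for 6 x H = 6 exp
  \<phi> H^3, with an error below sqrt 6 H.\<close>

lemma six_coupling_bounds:
  assumes "sqrt 6 < w"
  shows "6 * coupling w < w" "w < 6 * coupling w + sqrt 6"
proof -
  have w: "w > 0" using assms by (simp add: sqrt6_less_iff)
  have c: "6 * coupling w = w - sqrt 6 * (sqrt 6 / w)"
    using w by (simp add: coupling_def field_simps power2_eq_square)
  show "6 * coupling w < w" unfolding c using w by simp
  have "sqrt 6 / w < 1" using assms w by simp
  then have "sqrt 6 * (sqrt 6 / w) < sqrt 6 * 1" by (intro mult_strict_left_mono) auto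
  then show "w < 6 * coupling w + sqrt 6" unfolding c by linarith
qed

section \<open>Estimates for positive times\<close>

text \<open>Comparison of increments, so that the known data may sit at either end: a = 0 for
  positive times, b = 0 for negative ones.\<close>

lemma DERIV_less_imp_diff_less:
  fixes f g :: "real \<Rightarrow> real"
  assumes "a < b"
    and f: "\<And>t. a \<le> t \<Longrightarrow> t \<le> b \<Longrightarrow> (f has_real_derivative f' t) (at t)"
    and g: "\<And>t. a \<le> t \<Longrightarrow> t \<le> b \<Longrightarrow> (g has_real_derivative g' t) (at t)"
    and less: "\<And>t. a \<le> t \<Longrightarrow> t \<le> b \<Longrightarrow> f' t < g' t"
  shows "f b - f a < g b - g a"
proof -
  have "g a - f a < g b - f b"
  proof (rule DERIV_pos_imp_increasing[OF \<open>a < b\<close>, where f = "\<lambda>t. g t - f t"])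
    fix t assume "a \<le> t" "t \<le> b"
    then have "((\<lambda>t. g t - f t) has_real_derivative g' t - f' t) (at t)" "0 < g' t - f' t"
      using f g less[of t] by (simp_all add: DERIV_diff)
    then show "\<exists>y. ((\<lambda>t. g t - f t) has_real_derivative y) (at t) \<and> 0 < y" by blast
  qed
  then show ?thesis by simp
qed

text \<open>What the estimates use of a solution, with w in the role of - \<phi>' / H and the
  constraint in solved form.\<close>

locale reduced_flow =
  fixes \<beta> :: real and H \<phi> w :: "real \<Rightarrow> real"
  assumes \<beta>_pos: "0 < \<beta>" and \<beta>_less: "\<beta> < sqrt 6 / 6"
    and H_pos: "\<And>t. 0 < H t"
    and w_gt: "\<And>t. sqrt 6 < w t"
    and DERIV_H: "\<And>t. (H has_real_derivative (H t)^2 * hub_rate (w t)) (at t)"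
    and DERIV_w: "\<And>t. (w has_real_derivative H t * ratio_rate (w t)) (at t)"
    and DERIV_\<phi>: "\<And>t. (\<phi> has_real_derivative - (w t * H t)) (at t)"
    and constraint: "\<And>t. exp (\<phi> t) * (H t)^2 = coupling (w t)"
    and H_0: "H 0 = \<beta>" and \<phi>_0: "\<phi> 0 = 0"
begin

lemma w_pos: "0 < w t"
  using w_gt[of t] by (simp add: sqrt6_less_iff)

lemma \<beta>_sq: "\<beta>^2 < 1 / 6"
  using power_strict_mono[OF \<beta>_less, of 2] \<beta>_pos by (simp add: power2_eq_square)

lemma w_strict_antimono:
  assumes "s < t" shows "w t < w s"
proof (rule DERIV_neg_imp_decreasing[OF assms])
  fix r
  have "H r * ratio_rate (w r) < 0"
    by (intro mult_pos_neg H_pos ratio_rate_neg w_gt)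
  then show "\<exists>y. (w has_real_derivative y) (at r) \<and> y < 0"
    using DERIV_w by blast
qed

lemma coupling_0: "coupling (w 0) = \<beta>^2"
  using constraint[of 0] by (simp add: H_0 \<phi>_0)

text \<open>The bound \<beta> < sqrt 6 / 6 enters here: \<open>coupling 3\<close> is 1/6, and
  \<open>coupling (w 0)\<close> is \<beta>^2.\<close>

lemma w_less_3: "w 0 < 3"
proof (rule ccontr)
  assume "\<not> w 0 < 3"
  then have "coupling 3 \<le> coupling (w 0)"
    using coupling_strict_mono[of 3 "w 0"] by (cases "w 0 = 3") auto
  moreover have "coupling 3 = 1 / 6" by (simp add: coupling_def)
  ultimately show False using \<beta>_sq coupling_0 by simp
qed

lemma coupling_strict_antimono: "s < t \<Longrightarrow> coupling (w t) < coupling (w s)"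
  by (intro coupling_strict_mono w_pos w_strict_antimono)

lemma coupling_ge: "t \<le> 0 \<Longrightarrow> \<beta>^2 \<le> coupling (w t)"
  using coupling_strict_antimono[of t 0] coupling_0 by (cases "t = 0") (simp_all add: less_imp_le)

lemma coupling_less: "0 < t \<Longrightarrow> coupling (w t) < \<beta>^2"
  using coupling_strict_antimono[of 0 t] coupling_0 by simp

text \<open>The derivative of 1 / H is - h, which lies between 1/2 and 5 because w stays in (sqrt 6,
  3).\<close>

lemma H_forward:
  assumes "0 < t"
  shows "1 / (5 * t + 1 / \<beta>) < H t" "H t < 1 / (1 / 2 * t + 1 / \<beta>)"
proof -
  have D: "((\<lambda>t. 1 / H t) has_real_derivative - hub_rate (w s)) (at s)" for s
    using H_pos[of s] by (auto intro!: derivative_eq_intros DERIV_H simp: field_simps power2_eq_square)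
  have w: "w s < 3" if "0 \<le> s" for s
    using w_strict_antimono[of 0 s] w_less_3 that by (cases "s = 0") auto
  have lin: "((\<lambda>t. c * t) has_real_derivative c) (at s)" for c s :: real
    by (auto intro!: derivative_eq_intros)
  have "1 / H t - 1 / H 0 < 5 * t - 5 * 0"
  proof (rule DERIV_less_imp_diff_less[OF assms D lin])
    fix s :: real assume "0 \<le> s"
    then show "- hub_rate (w s) < 5"
      using hub_rate_bounds_late(1)[OF w_gt w, of s] by simp
  qed
  then have "1 / H t < 5 * t + 1 / \<beta>" by (simp add: H_0)
  moreover have "0 < 5 * t + 1 / \<beta>" using assms \<beta>_pos by (intro add_pos_pos) auto
  ultimately have "1 / (5 * t + 1 / \<beta>) < 1 / (1 / H t)"
    using H_pos[of t] by (intro divide_strict_left_mono mult_pos_pos) auto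
  then show "1 / (5 * t + 1 / \<beta>) < H t" by simp
  have "1 / 2 * t - 1 / 2 * 0 < 1 / H t - 1 / H 0"
  proof (rule DERIV_less_imp_diff_less[OF assms lin D])
    fix s :: real assume "0 \<le> s"
    then show "1 / 2 < - hub_rate (w s)"
      using hub_rate_bounds_late(2)[OF w_gt w, of s] by simp
  qed
  then have "1 / 2 * t + 1 / \<beta> < 1 / H t" by (simp add: H_0)
  moreover have "0 < 1 / 2 * t + 1 / \<beta>" using assms \<beta>_pos by (intro add_pos_pos) auto
  ultimately have "1 / (1 / H t) < 1 / (1 / 2 * t + 1 / \<beta>)"
    using H_pos[of t] by (intro divide_strict_left_mono mult_pos_pos) auto
  then show "H t < 1 / (1 / 2 * t + 1 / \<beta>)" by simp
qed

text \<open>In - \<phi>' = w H the first factor is below 6 \<beta>^2 + sqrt 6, since x <= \<beta>^2,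
  and the second is bounded by \<open>H_forward\<close>; the product of the bounds integrates to the
  logarithm.\<close>

lemma \<phi>_forward_lower:
  assumes "0 < t"
  shows "- (12 * \<beta>^2 + 2 * sqrt 6) * ln (1 / 2 * \<beta> * t + 1) < \<phi> t"
proof -
  define K where "K = 12 * \<beta>^2 + 2 * sqrt 6"
  have K: "K > 0" by (simp add: K_def add_nonneg_pos)
  have "- K * ln (1 / 2 * \<beta> * t + 1) - (- K * ln (1 / 2 * \<beta> * 0 + 1)) < \<phi> t - \<phi> 0"
  proof (rule DERIV_less_imp_diff_less[OF assms _ DERIV_\<phi>])
    fix s :: real assume s: "0 \<le> s" "s \<le> t"
    have pos: "0 < 1 / 2 * \<beta> * s + 1" using s \<beta>_pos by (simp add: add_nonneg_pos)
    show "((\<lambda>t. - K * ln (1 / 2 * \<beta> * t + 1)) has_real_derivative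
        - (K / 2 * (\<beta> / (1 / 2 * \<beta> * s + 1)))) (at s)"
      using pos by (auto intro!: derivative_eq_intros simp: field_simps)
    have "H s \<le> \<beta> / (1 / 2 * \<beta> * s + 1)"
    proof (cases "s = 0")
      case False
      have "1 / (1 / 2 * s + 1 / \<beta>) = \<beta> / (1 / 2 * \<beta> * s + 1)"
        using \<beta>_pos by (simp add: field_simps)
      then show ?thesis using H_forward(2)[of s] False s by simp
    qed (simp add: H_0)
    moreover have "w s < K / 2"
      using six_coupling_bounds(2)[OF w_gt[of s]] coupling_less[of s] coupling_0 s
      by (cases "s = 0") (auto simp: K_def)
    ultimately have "w s * H s < K / 2 * (\<beta> / (1 / 2 * \<beta> * s + 1))"
      using H_pos[of s] w_pos[of s] K by (intro mult_less_le_imp_less) auto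
    then show "- (K / 2 * (\<beta> / (1 / 2 * \<beta> * s + 1))) < - (w s * H s)" by simp
  qed
  then show ?thesis by (simp add: \<phi>_0 K_def)
qed

text \<open>(exp (- \<phi>))' = exp (- \<phi>) w H > 6 exp (- \<phi>) x H = 6 H^3, and
  \<open>H_forward\<close> bounds H below; integrating 6 / (5 t + 1/\<beta>)^3 produces the factor
  3/5.\<close>

lemma \<phi>_forward_upper:
  assumes "0 < t"
  shows "\<phi> t < - ln (1 + 3 / 5 * (\<beta>^2 - 1 / (5 * t + 1 / \<beta>)^2))"
proof -
  have D: "((\<lambda>t. - (3 / 5) / (5 * t + c)^2) has_real_derivative 6 * (1 / (5 * s + c))^3) (at s)"
    if "5 * s + c \<noteq> 0" for c s :: real
  proof -
    define k where "k = 5 * s + c"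
    have "((\<lambda>t. 5 * t + c) has_real_derivative 5) (at s)"
      by (auto intro!: derivative_eq_intros)
    then have "((\<lambda>t. inverse (5 * t + c)) has_real_derivative - (inverse k * 5 * inverse k)) (at s)"
      unfolding k_def using that by (rule DERIV_inverse')
    then have "((\<lambda>t. - (3 / 5) * (inverse (5 * t + c) * inverse (5 * t + c))) has_real_derivative
        - (3 / 5) * (inverse k * - (inverse k * 5 * inverse k) + - (inverse k * 5 * inverse k) * inverse k)) (at s)"
      unfolding k_def by (intro DERIV_cmult DERIV_mult')
    moreover have "- (3 / 5) * (inverse k * - (inverse k * 5 * inverse k) + - (inverse k * 5 * inverse k) * inverse k)
        = 6 * (1 / k)^3"
      using that by (simp add: k_def[symmetric] field_simps power3_eq_cube)
    moreover have "(\<lambda>t. - (3 / 5) / (5 * t + c)^2) = (\<lambda>t. - (3 / 5) * (inverse (5 * t + c) * inverse (5 * t + c)))"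
      by (simp add: fun_eq_iff field_simps power2_eq_square)
    ultimately show ?thesis by (simp only: k_def)
  qed
  have pos: "0 < 5 * s + 1 / \<beta>" if "0 \<le> s" for s
    using that \<beta>_pos by (simp add: add_nonneg_pos)
  have "- (3 / 5) / (5 * t + 1 / \<beta>)^2 - (- (3 / 5) / (5 * 0 + 1 / \<beta>)^2)
      < exp (- \<phi> t) - exp (- \<phi> 0)"
  proof (rule DERIV_less_imp_diff_less[OF assms])
    fix s :: real assume s: "0 \<le> s" "s \<le> t"
    show "((\<lambda>t. - (3 / 5) / (5 * t + 1 / \<beta>)^2) has_real_derivative
        6 * (1 / (5 * s + 1 / \<beta>))^3) (at s)"
      using pos[OF s(1)] by (intro D) simp
    show "((\<lambda>t. exp (- \<phi> t)) has_real_derivative exp (- \<phi> s) * (w s * H s)) (at s)"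
      by (auto intro!: derivative_eq_intros DERIV_\<phi>)
    have "1 / (5 * s + 1 / \<beta>) \<le> H s"
      using H_forward(1)[of s] s by (cases "s = 0") (auto simp: H_0)
    then have "(1 / (5 * s + 1 / \<beta>))^3 \<le> H s ^ 3"
      using pos[OF s(1)] by (intro power_mono) auto
    also have "H s ^ 3 = exp (- \<phi> s) * (coupling (w s) * H s)"
      unfolding constraint[symmetric] by (simp add: exp_minus power2_eq_square power3_eq_cube)
    finally have "6 * (1 / (5 * s + 1 / \<beta>))^3 \<le> exp (- \<phi> s) * ((6 * coupling (w s)) * H s)"
      by simp
    also have "\<dots> < exp (- \<phi> s) * (w s * H s)"
      using six_coupling_bounds(1)[OF w_gt[of s]] H_pos[of s] by simp
    finally show "6 * (1 / (5 * s + 1 / \<beta>))^3 < exp (- \<phi> s) * (w s * H s)" .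
  qed
  then have *: "1 + 3 / 5 * (\<beta>^2 - 1 / (5 * t + 1 / \<beta>)^2) < exp (- \<phi> t)"
    by (simp add: \<phi>_0 power_divide field_simps)
  have "(1 / (5 * t + 1 / \<beta>))^2 \<le> \<beta>^2"
  proof (rule power_mono)
    have "1 / (5 * t + 1 / \<beta>) \<le> 1 / (1 / \<beta>)"
      using assms \<beta>_pos pos[of t] by (intro divide_left_mono) auto
    then show "1 / (5 * t + 1 / \<beta>) \<le> \<beta>" by simp
  qed (use pos[of t] assms in simp)
  then have "0 < 1 + 3 / 5 * (\<beta>^2 - 1 / (5 * t + 1 / \<beta>)^2)"
    by (simp add: power_divide add_pos_nonneg)
  then have "ln (1 + 3 / 5 * (\<beta>^2 - 1 / (5 * t + 1 / \<beta>)^2)) < - \<phi> t"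
    using * by (simp add: ln_less_cancel_iff[symmetric] del: ln_less_cancel_iff)
  then show ?thesis by simp
qed

end

section \<open>Estimates for negative times\<close>

lemma powr_mult_power: "0 < x \<Longrightarrow> x powr a * x ^ n = x powr (a + real n)" for x :: real
  by (simp add: powr_add powr_realpow)

context reduced_flow
begin

text \<open>\<beta>^3 / u solves z' = 3 z^2, z(0) = \<beta>^3; it is the comparison function for z =
  exp \<phi> H^3.\<close>

definition u :: "real \<Rightarrow> real" where
  "u t = - 3 * \<beta>^3 * t + 1"

lemma u_0 [simp]: "u 0 = 1"
  by (simp add: u_def)

lemma u_ge_1: "t \<le> 0 \<Longrightarrow> 1 \<le> u t"
  using \<beta>_pos by (simp add: u_def mult_nonneg_nonpos)

lemma u_pos: "t \<le> 0 \<Longrightarrow> 0 < u t"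
  using u_ge_1[of t] by simp

lemma DERIV_u: "(u has_real_derivative - (3 * \<beta>^3)) (at t)"
  unfolding u_def by (auto intro!: derivative_eq_intros)

lemma DERIV_ln_u: "t \<le> 0 \<Longrightarrow> ((\<lambda>t. c * ln (u t)) has_real_derivative - (c * (3 * \<beta>^3) / u t)) (at t)"
  using u_pos[of t] by (auto intro!: derivative_eq_intros DERIV_u)

lemma DERIV_ln_H: "((\<lambda>t. \<phi> t + c * ln (H t)) has_real_derivative H t * (c * hub_rate (w t) - w t)) (at t)"
  using H_pos[of t]
  by (auto intro!: derivative_eq_intros DERIV_H DERIV_\<phi> simp: field_simps power2_eq_square)

lemma DERIV_exp_H:
  "((\<lambda>t. exp (\<phi> t) * H t) has_real_derivative coupling (w t) * (hub_rate (w t) - w t)) (at t)"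
  unfolding constraint[symmetric]
  by (auto intro!: derivative_eq_intros DERIV_H DERIV_\<phi> simp: algebra_simps power2_eq_square)

lemma \<beta>_cube: "\<beta>^3 < 1 / 6"
proof -
  have "\<beta> < 1" using \<beta>_sq \<beta>_pos power2_less_imp_less[of \<beta> 1] by simp
  then have "\<beta>^2 * \<beta> < \<beta>^2 * 1" using \<beta>_pos by (intro mult_strict_left_mono) auto
  then show ?thesis using \<beta>_sq by (simp add: power2_eq_square power3_eq_cube)
qed

text \<open>For z = exp \<phi> H^3 = H x, z' < 3 z^2 means (1/z)' > - 3. Integrating from t to 0
  gives 1 / z(t) < 1 / \<beta>^3 - 3 t = u / \<beta>^3.\<close>

lemma H_coupling_lower:
  assumes "t \<le> 0" shows "\<beta>^3 / u t \<le> H t * coupling (w t)"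
proof (cases "t = 0")
  case True
  then show ?thesis by (simp add: H_0 coupling_0 power2_eq_square power3_eq_cube)
next
  case False
  have z: "exp (\<phi> s) * H s ^ 3 = H s * coupling (w s)" for s
    unfolding constraint[symmetric] by (simp add: power2_eq_square power3_eq_cube)
  have z_pos: "0 < H s * coupling (w s)" for s
    by (intro mult_pos_pos H_pos coupling_pos w_gt)
  have "t < 0" using assms False by simp
  then have "- 3 * 0 - (- 3 * t) < 1 / (exp (\<phi> 0) * H 0 ^ 3) - 1 / (exp (\<phi> t) * H t ^ 3)"
  proof (rule DERIV_less_imp_diff_less)
    fix s
    show "((\<lambda>s. - 3 * s) has_real_derivative - 3) (at s)"
      by (auto intro!: derivative_eq_intros)
    define Z where "Z = (\<lambda>s. exp (\<phi> s) * H s ^ 3)"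
    have Z: "Z s = H s * coupling (w s)" "0 < Z s"
      using z z_pos by (simp_all add: Z_def)
    have DZ: "(Z has_real_derivative Z s * (H s * (3 * hub_rate (w s) - w s))) (at s)"
      unfolding Z_def by (auto intro!: derivative_eq_intros DERIV_H DERIV_\<phi>
          simp: algebra_simps power2_eq_square power3_eq_cube)
    have "((\<lambda>s. 1 / Z s) has_real_derivative - (H s * (3 * hub_rate (w s) - w s) / Z s)) (at s)"
      using Z(2) by (auto intro!: derivative_eq_intros DZ simp: field_simps)
    then show "((\<lambda>s. 1 / (exp (\<phi> s) * H s ^ 3)) has_real_derivative
        - (H s * (3 * hub_rate (w s) - w s) / (H s * coupling (w s)))) (at s)"
      by (simp only: Z(1)) (simp only: Z_def)
    have "H s * (3 * hub_rate (w s) - w s) < H s * (3 * coupling (w s))"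
      using hub_rate_upper(2)[OF w_gt[of s]] H_pos[of s] by (intro mult_strict_left_mono) auto
    then show "- 3 < - (H s * (3 * hub_rate (w s) - w s) / (H s * coupling (w s)))"
      using z_pos[of s] by (simp add: divide_less_eq algebra_simps)
  qed
  then have "1 / (H t * coupling (w t)) < 1 / \<beta>^3 - 3 * t"
    unfolding z by (simp add: coupling_0 H_0 power2_eq_square power3_eq_cube)
  also have "\<dots> = u t / \<beta>^3" using \<beta>_pos by (simp add: u_def field_simps)
  finally have "1 / (H t * coupling (w t)) < u t / \<beta>^3" .
  then have "1 / (u t / \<beta>^3) < 1 / (1 / (H t * coupling (w t)))"
    using z_pos[of t] u_pos[OF assms] \<beta>_pos by (intro divide_strict_left_mono mult_pos_pos) auto
  then show ?thesis by simp
qed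

text \<open>- \<phi>' = w H > 6 x H >= 6 \<beta>^3 / u, and the last term is - (2 ln u)'.\<close>

lemma \<phi>_backward_lower:
  assumes "t < 0" shows "ln ((u t)^2) < \<phi> t"
proof -
  have "\<phi> 0 - \<phi> t < 2 * ln (u 0) - 2 * ln (u t)"
  proof (rule DERIV_less_imp_diff_less[OF assms DERIV_\<phi> DERIV_ln_u])
    fix s :: real assume "s \<le> 0"
    have "2 * (3 * \<beta>^3) / u s \<le> H s * (6 * coupling (w s))"
      using H_coupling_lower[OF \<open>s \<le> 0\<close>] by simp
    also have "\<dots> < H s * w s"
      using six_coupling_bounds(1)[OF w_gt[of s]] H_pos[of s] by (intro mult_strict_left_mono) auto
    finally show "- (w s * H s) < - (2 * (3 * \<beta>^3) / u s)" by (simp add: mult.commute)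
  qed
  then show ?thesis using u_pos[of t] assms by (simp add: \<phi>_0 ln_realpow)
qed

text \<open>Feeding u^2 <= exp \<phi> into the constraint shows that a large H u forces a large
  coupling, hence a large h; this is what limits H u.\<close>

lemma H_u_sq_le:
  assumes "t \<le> 0" shows "(H t * u t)^2 \<le> coupling (w t)"
proof -
  have "(u t)^2 \<le> exp (\<phi> t)"
  proof (cases "t = 0")
    case False
    then have "exp (ln ((u t)^2)) < exp (\<phi> t)" using \<phi>_backward_lower[of t] assms by simp
    then show ?thesis using u_pos[OF assms] by simp
  qed (simp add: \<phi>_0)
  then have "(u t)^2 * (H t)^2 \<le> coupling (w t)"
    unfolding constraint[symmetric] by (intro mult_right_mono) auto
  then show ?thesis by (simp add: power_mult_distrib mult.commute)
qed

text \<open>When \<open>H u\<close> reaches \<open>sqrt 3\<close>, the coupling is at least 3, so that \<open>H\<close>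
  grows fast enough for \<open>H u\<close> to be increasing in \<open>t\<close>; hence it could not have come down to
  its value at 0.\<close>

lemma H_u_less_sqrt3:
  assumes "t \<le> 0" shows "H t * u t < sqrt 3"
proof (rule ccontr)
  assume "\<not> H t * u t < sqrt 3"
  define v where "v = (\<lambda>t. H t * u t)"
  define S where "S = {s \<in> {t..0}. sqrt 3 \<le> v s}"
  have Dv: "(v has_real_derivative H s * (v s * hub_rate (w s) - 3 * \<beta>^3)) (at s)" for s
    unfolding v_def
    by (auto intro!: derivative_eq_intros DERIV_H DERIV_u simp: algebra_simps power2_eq_square)
  have "continuous_on {t..0} v"
    using Dv by (meson DERIV_isCont continuous_at_imp_continuous_on)
  then have "closed S"
    unfolding S_def by (intro continuous_closed_preimage_constant continuous_on_closed_Collect_le continuous_intros closed_atLeastAtMost)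
  moreover have "bounded S"
    by (rule bounded_subset[of "{t..0}"]) (auto simp: S_def)
  moreover have "t \<in> S"
    using \<open>\<not> H t * u t < sqrt 3\<close> assms by (simp add: S_def v_def)
  ultimately obtain s where s: "s \<in> S" and max: "\<And>r. r \<in> S \<Longrightarrow> r \<le> s"
    using compact_attains_sup[of S] compact_eq_bounded_closed by blast
  have sqrt3: "1 \<le> sqrt 3" by simp
  have vs: "sqrt 3 \<le> v s" "s \<le> 0" "t \<le> s" using s by (auto simp: S_def)
  have "\<beta> < 1" using \<beta>_sq \<beta>_pos power2_less_imp_less[of \<beta> 1] by simp
  have "s \<noteq> 0"
  proof
    assume "s = 0"
    then have "sqrt 3 \<le> \<beta>" using vs(1) by (simp add: v_def H_0)
    with \<open>\<beta> < 1\<close> sqrt3 show False by linarith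
  qed
  have "(sqrt 3)^2 \<le> (v s)^2" using vs by (intro power_mono) auto
  then have "3 \<le> coupling (w s)" using H_u_sq_le[OF vs(2)] by (simp add: v_def)
  \<comment> \<open>With x >= 3 the rate exceeds - 3 + 36/5, while 3 \<beta>^3 < 1/2; so v increases
    just after s, although s is the last time in [t, 0] with v >= sqrt 3.\<close>
  then have "1 \<le> hub_rate (w s)" using hub_rate_lower(1)[OF w_gt[of s]] by simp
  moreover have "1 \<le> v s" using vs sqrt3 by linarith
  ultimately have "1 * 1 \<le> v s * hub_rate (w s)" by (intro mult_mono) auto
  then have "0 < H s * (v s * hub_rate (w s) - 3 * \<beta>^3)"
    using \<beta>_cube by (intro mult_pos_pos H_pos) simp
  from DERIV_pos_inc_right[OF Dv this] obtain d where "d > 0"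
    and d: "\<And>h. 0 < h \<Longrightarrow> h < d \<Longrightarrow> v s < v (s + h)" by blast
  define h where "h = min (d / 2) (- s)"
  have h: "0 < h" "h < d" "h \<le> - s" using \<open>d > 0\<close> \<open>s \<noteq> 0\<close> vs by (auto simp: h_def)
  then have "s + h \<in> S" using d[of h] vs by (simp add: S_def)
  from max[OF this] h show False by simp
qed

text \<open>(exp \<phi> H)' = x (h - w) < - x, and x, being decreasing, is at least \<beta>^2 at
  nonpositive times. It is applied with c = \<theta>.\<close>

lemma exp_H_lower:
  assumes "t \<le> 0" "c \<le> \<beta>^2" shows "\<beta> - c * t \<le> exp (\<phi> t) * H t"
proof (cases "t = 0")
  case False
  then have "t < 0" using assms by simp
  then have "exp (\<phi> 0) * H 0 - exp (\<phi> t) * H t < - c * 0 - (- c * t)"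
  proof (rule DERIV_less_imp_diff_less[OF _ DERIV_exp_H])
    fix s :: real assume "s \<le> 0"
    show "((\<lambda>s. - c * s) has_real_derivative - c) (at s)"
      by (auto intro!: derivative_eq_intros)
    have "coupling (w s) * 1 < coupling (w s) * (w s - hub_rate (w s))"
      using hub_rate_upper(3)[OF w_gt[of s]] coupling_pos[OF w_gt[of s]]
      by (intro mult_strict_left_mono) auto
    then show "coupling (w s) * (hub_rate (w s) - w s) < - c"
      using coupling_ge[OF \<open>s \<le> 0\<close>] assms by (simp add: algebra_simps)
  qed
  then show ?thesis by (simp add: \<phi>_0 H_0)
qed (simp add: \<phi>_0 H_0)

section \<open>Backward bounds with constants depending on \<gamma>\<close>

context
  fixes \<gamma> :: real
  assumes \<gamma>: "sqrt 3 \<le> \<gamma>"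
begin

lemma H_less_\<gamma>_div: "t \<le> 0 \<Longrightarrow> H t < \<gamma> / u t"
  using H_u_less_sqrt3[of t] u_pos[of t] \<gamma> by (simp add: pos_less_divide_eq)

lemma H_less_\<gamma>:
  assumes "t \<le> 0" shows "H t < \<gamma>"
proof -
  have "H t * 1 \<le> H t * u t"
    using H_pos[of t] u_ge_1[OF assms] by (intro mult_left_mono) auto
  then show ?thesis using H_u_less_sqrt3[OF assms] \<gamma> by linarith
qed

text \<open>y = 1 / H^2 satisfies y' < 6 \<gamma> y - 24/5 (\<beta> - \<theta> t), by h > - 3 + 12/5
  x, 1 / H <= \<gamma> / H^2 and \<open>exp_H_lower\<close>. The bracket solves the corresponding
  linear equation with value 1 / \<beta>^2 at 0; exp (- 6 \<gamma> t) is the integrating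
  factor.\<close>

lemma H_backward_upper:
  assumes "t < 0" "0 < \<theta>" "\<theta> \<le> \<beta>^2"
  shows "H t < (exp (6 * \<gamma> * t) * (1 / \<beta>^2 - 4 * \<beta> / (5 * \<gamma>) + 2 * \<theta> / (15 * \<gamma>^2))
    - 2 * (- 6 * \<beta> * \<gamma> + \<theta> + 6 * \<gamma> * \<theta> * t) / (15 * \<gamma>^2)) powr (- 1 / 2)"
proof -
  define A where "A = 1 / \<beta>^2 - 4 * \<beta> / (5 * \<gamma>) + 2 * \<theta> / (15 * \<gamma>^2)"
  define B where "B = (\<lambda>t. 2 * (- 6 * \<beta> * \<gamma> + \<theta> + 6 * \<gamma> * \<theta> * t) / (15 * \<gamma>^2))"
  have \<gamma>1: "1 < \<gamma>" using \<gamma> less_le_trans[of 1 "sqrt 3" \<gamma>] by simp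
  have "\<beta> < 1" using \<beta>_sq \<beta>_pos power2_less_imp_less[of \<beta> 1] by simp
  have "exp (- 6 * \<gamma> * 0) / (H 0)^2 - exp (- 6 * \<gamma> * t) / (H t)^2
      < (A - exp (- 6 * \<gamma> * 0) * B 0) - (A - exp (- 6 * \<gamma> * t) * B t)"
  proof (rule DERIV_less_imp_diff_less[OF \<open>t < 0\<close>])
    fix s :: real assume s: "s \<le> 0"
    show "((\<lambda>t. exp (- 6 * \<gamma> * t) / (H t)^2) has_real_derivative
        exp (- 6 * \<gamma> * s) * (- 6 * \<gamma> / (H s)^2 - 2 * hub_rate (w s) / H s)) (at s)"
      using H_pos[of s]
      by (auto intro!: derivative_eq_intros DERIV_H simp: field_simps eval_nat_numeral)
    have DB: "(B has_real_derivative 4 * \<theta> / (5 * \<gamma>)) (at s)"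
      unfolding B_def using \<gamma>1
      by (auto intro!: derivative_eq_intros simp: field_simps power2_eq_square)
    have "6 * \<gamma> * B s - 4 * \<theta> / (5 * \<gamma>) = - (24 / 5 * (\<beta> - \<theta> * s))"
      unfolding B_def using \<gamma>1 by (simp add: field_simps power2_eq_square)
    moreover have "((\<lambda>t. A - exp (- 6 * \<gamma> * t) * B t) has_real_derivative
        exp (- 6 * \<gamma> * s) * (6 * \<gamma> * B s - 4 * \<theta> / (5 * \<gamma>))) (at s)"
      by (auto intro!: derivative_eq_intros DB simp: algebra_simps)
    ultimately show "((\<lambda>t. A - exp (- 6 * \<gamma> * t) * B t) has_real_derivative
        exp (- 6 * \<gamma> * s) * - (24 / 5 * (\<beta> - \<theta> * s))) (at s)" by simp
    have "H s / (H s)^2 \<le> \<gamma> / (H s)^2"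
      using H_less_\<gamma>[OF s] by (intro divide_right_mono) auto
    then have 1: "6 / H s \<le> 6 * \<gamma> / (H s)^2" using H_pos[of s] by (simp add: power2_eq_square)
    have "- 2 * hub_rate (w s) / H s < (6 - 24 / 5 * coupling (w s)) / H s"
      using hub_rate_lower(1)[OF w_gt[of s]] H_pos[of s] by (intro divide_strict_right_mono) auto
    also have "\<dots> = 6 / H s - 24 / 5 * (exp (\<phi> s) * H s)"
      using H_pos[of s] unfolding constraint[symmetric] by (simp add: field_simps power2_eq_square)
    also have "\<dots> \<le> 6 * \<gamma> / (H s)^2 - 24 / 5 * (\<beta> - \<theta> * s)"
      using 1 exp_H_lower[OF s assms(3)] by (intro diff_mono mult_left_mono) auto
    finally have "- 6 * \<gamma> / (H s)^2 - 2 * hub_rate (w s) / H s < - (24 / 5 * (\<beta> - \<theta> * s))" by simp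
    then show "exp (- 6 * \<gamma> * s) * (- 6 * \<gamma> / (H s)^2 - 2 * hub_rate (w s) / H s)
        < exp (- 6 * \<gamma> * s) * - (24 / 5 * (\<beta> - \<theta> * s))"
      by (intro mult_strict_left_mono) auto
  qed
  moreover have "A - B 0 = 1 / \<beta>^2"
    using \<gamma>1 by (simp add: A_def B_def field_simps power2_eq_square)
  ultimately have "A - exp (- 6 * \<gamma> * t) * B t < exp (- 6 * \<gamma> * t) / (H t)^2"
    by (simp add: H_0)
  then have "exp (6 * \<gamma> * t) * (A - exp (- 6 * \<gamma> * t) * B t)
      < exp (6 * \<gamma> * t) * (exp (- 6 * \<gamma> * t) / (H t)^2)"
    by (intro mult_strict_left_mono) auto
  then have less: "exp (6 * \<gamma> * t) * A - B t < 1 / (H t)^2"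
    by (simp add: right_diff_distrib mult.assoc[symmetric] exp_add[symmetric])
  \<comment> \<open>The bracket must be positive before the power - 1/2 can reverse the inequality;
    this inequality gives B t < 0, and A > 0 follows from \<beta> < 1 < \<gamma>.\<close>
  have "\<theta> < \<beta> * \<gamma>"
  proof -
    have "\<beta> * \<beta> < \<beta> * \<gamma>" using \<open>\<beta> < 1\<close> \<gamma>1 \<beta>_pos by (intro mult_strict_left_mono) auto
    then show ?thesis using assms(3) by (simp add: power2_eq_square)
  qed
  moreover have "\<gamma> * \<theta> * t < 0" using assms \<gamma>1 by (simp add: mult_pos_neg)
  moreover have "0 < \<beta> * \<gamma>" using \<beta>_pos \<gamma>1 by simp
  ultimately have "B t < 0"
    unfolding B_def using \<gamma>1 by (intro divide_neg_pos) auto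
  moreover have "0 < A"
  proof -
    have "4 * \<beta> / (5 * \<gamma>) < 1"
      using \<open>\<beta> < 1\<close> \<gamma>1 by (simp add: divide_less_eq)
    moreover have "1 < 1 / \<beta>^2" using \<beta>_sq \<beta>_pos by (simp add: less_divide_eq)
    moreover have "0 < 2 * \<theta> / (15 * \<gamma>^2)" using assms \<gamma>1 by simp
    ultimately show ?thesis by (simp add: A_def)
  qed
  ultimately have "0 < exp (6 * \<gamma> * t) * A - B t"
    using mult_pos_pos[OF exp_gt_zero \<open>0 < A\<close>] by (metis diff_gt_0_iff_gt less_trans)
  then have "(1 / (H t)^2) powr (- 1 / 2) < (exp (6 * \<gamma> * t) * A - B t) powr (- 1 / 2)"
    using less by (intro powr_less_mono2_neg) auto
  moreover have "(1 / (H t)^2) powr (- 1 / 2) = H t"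
  proof -
    have "1 / (H t)^2 = H t powr (- 2)"
      using H_pos[of t] by (simp add: powr_minus divide_inverse powr_numeral)
    then show ?thesis using H_pos[of t] by (simp add: powr_powr)
  qed
  ultimately show ?thesis by (simp add: A_def B_def)
qed

text \<open>- \<phi>' = w H < sqrt 6 H + 6 exp \<phi> H^3, where H < \<gamma> / u. The logarithmic
  derivative of exp \<phi> H^3 exceeds - 12 H > - 12 \<gamma> / u, so this monomial is at most
  \<beta>^3 u^e with e = 4 \<gamma> / \<beta>^3.\<close>

lemma \<phi>_backward_upper:
  assumes "t < 0"
  shows "\<phi> t < sqrt 6 * \<gamma> / (3 * \<beta>^3) * ln (u t)
    + 2 * \<beta>^3 / (4 * \<gamma> + \<beta>^3) * (u t powr ((4 * \<gamma> + \<beta>^3) / \<beta>^3) - 1)"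
proof -
  define e where "e = 4 * \<gamma> / \<beta>^3"
  have b: "0 < \<beta>^3" using \<beta>_pos by simp
  have \<gamma>_pos: "0 < \<gamma>" using \<gamma> less_le_trans[of 0 "sqrt 3" \<gamma>] by simp
  have e: "(4 * \<gamma> + \<beta>^3) / \<beta>^3 = e + 1" "e > 0" using b \<gamma>_pos by (auto simp: e_def field_simps)
  have z: "H s * coupling (w s) \<le> \<beta>^3 * u s powr e" if "s \<le> 0" for s
  proof -
    have "e * ln (u 0) - e * ln (u s) \<le> (\<phi> 0 + 3 * ln (H 0)) - (\<phi> s + 3 * ln (H s))"
    proof (cases "s = 0")
      case False
      then have "s < 0" using that by simp
      then have "e * ln (u 0) - e * ln (u s) < (\<phi> 0 + 3 * ln (H 0)) - (\<phi> s + 3 * ln (H s))"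
      proof (rule DERIV_less_imp_diff_less[OF _ DERIV_ln_u DERIV_ln_H])
        fix r :: real assume r: "r \<le> 0"
        have "- (e * (3 * \<beta>^3) / u r) = - 12 * (\<gamma> / u r)"
          using b by (simp add: e_def field_simps)
        also have "\<dots> < - 12 * H r" using H_less_\<gamma>_div[OF r] by simp
        also have "\<dots> < H r * (3 * hub_rate (w r) - w r)"
          using mult_strict_left_mono[OF hub_rate_lower(3)[OF w_gt[of r]] H_pos[of r]] by simp
        finally show "- (e * (3 * \<beta>^3) / u r) < H r * (3 * hub_rate (w r) - w r)" .
      qed
      then show ?thesis by simp
    qed simp
    then have "exp (\<phi> s + 3 * ln (H s)) \<le> exp (3 * ln \<beta> + e * ln (u s))"
      by (simp add: \<phi>_0 H_0)
    moreover have "exp (\<phi> s + 3 * ln (H s)) = H s * coupling (w s)"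
      unfolding constraint[symmetric] using H_pos[of s] exp_of_nat_mult[of 3 "ln (H s)"]
      by (simp add: exp_add power2_eq_square power3_eq_cube)
    moreover have "exp (3 * ln \<beta> + e * ln (u s)) = \<beta>^3 * u s powr e"
      using \<beta>_pos u_pos[OF that] exp_of_nat_mult[of 3 "ln \<beta>"] by (simp add: exp_add powr_def)
    ultimately show ?thesis by simp
  qed
  define R where "R = (\<lambda>t. sqrt 6 * \<gamma> / (3 * \<beta>^3) * ln (u t) + 2 / (e + 1) * (u t powr (e + 1) - 1))"
  have "R 0 - R t < \<phi> 0 - \<phi> t"
  proof (rule DERIV_less_imp_diff_less[OF assms _ DERIV_\<phi>])
    fix s :: real assume s: "s \<le> 0"
    have "(R has_real_derivative - (sqrt 6 * \<gamma> / (3 * \<beta>^3) * (3 * \<beta>^3) / u s)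
        + 2 / (e + 1) * ((e + 1) * u s powr (e + 1 - 1) * - (3 * \<beta>^3) - 0)) (at s)"
      unfolding R_def
      by (intro DERIV_add DERIV_ln_u s DERIV_cmult DERIV_diff DERIV_const u_pos
          has_real_derivative_powr[THEN DERIV_chain2] DERIV_u)
    then show "(R has_real_derivative - (sqrt 6 * (\<gamma> / u s) + 6 * (\<beta>^3 * u s powr e))) (at s)"
      using b e by (simp add: mult.commute[of "u s powr e"])
    have "w s * H s < (6 * coupling (w s) + sqrt 6) * H s"
      using six_coupling_bounds(2)[OF w_gt[of s]] H_pos[of s] by (intro mult_strict_right_mono) auto
    also have "\<dots> = sqrt 6 * H s + 6 * (H s * coupling (w s))" by (simp add: algebra_simps)
    also have "\<dots> \<le> sqrt 6 * (\<gamma> / u s) + 6 * (\<beta>^3 * u s powr e)"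
      using H_less_\<gamma>_div[OF s] z[OF s] by (intro add_mono mult_left_mono) auto
    finally show "- (sqrt 6 * (\<gamma> / u s) + 6 * (\<beta>^3 * u s powr e)) < - (w s * H s)" by simp
  qed
  then have "\<phi> t < R t" by (simp add: \<phi>_0 R_def)
  moreover have "2 / (e + 1) = 2 * \<beta>^3 / (4 * \<gamma> + \<beta>^3)" unfolding e(1)[symmetric] by simp
  ultimately show ?thesis unfolding e(1) by (simp add: R_def)
qed

text \<open>(H^(-1/4))' = - h H^(3/4) / 4 > - 3/4 exp \<phi> H^(11/4), as h < 3 x. That monomial is
  at most \<beta>^(11/4) u^m, since its logarithmic derivative exceeds - 107/10 H + 3/5 H x >= - 3
  \<beta>^3 m / u; this is where the relation for m comes from. L is the resulting upper bound for
  H^(-1/4).\<close>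

lemma H_backward_lower:
  assumes "t < 0" and m: "3 * \<beta>^3 * m = 107 / 10 * \<gamma> - 3 / 5 * \<beta>^3"
  defines "L \<equiv> \<beta> powr (- 1 / 4) - \<beta> powr (- 1 / 4) / (4 * (m + 1)) * (1 - u t powr (m + 1))"
  shows "L powi (- 4) < H t" "0 < L powi (- 4)"
proof -
  have b: "0 < \<beta>^3" using \<beta>_pos by simp
  have "1 < \<gamma>" using \<gamma> less_le_trans[of 1 "sqrt 3" \<gamma>] by simp
  then have "0 < 3 * \<beta>^3 * m" using m \<beta>_cube by simp
  then have m_pos: "0 < m" using b by (simp add: zero_less_mult_iff)
  have M: "exp (\<phi> s) * H s powr (11 / 4) \<le> \<beta> powr (11 / 4) * u s powr m" if "s \<le> 0" for s
  proof -
    have "m * ln (u 0) - m * ln (u s) \<le> (\<phi> 0 + 11 / 4 * ln (H 0)) - (\<phi> s + 11 / 4 * ln (H s))"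
    proof (cases "s = 0")
      case False
      then have "s < 0" using that by simp
      then have "m * ln (u 0) - m * ln (u s) < (\<phi> 0 + 11 / 4 * ln (H 0)) - (\<phi> s + 11 / 4 * ln (H s))"
      proof (rule DERIV_less_imp_diff_less[OF _ DERIV_ln_u DERIV_ln_H])
        fix r :: real assume r: "r \<le> 0"
        have "m * (3 * \<beta>^3) = 107 / 10 * \<gamma> - 3 / 5 * \<beta>^3" using m by (simp add: mult.commute)
        then have "- (m * (3 * \<beta>^3) / u r) = - 107 / 10 * (\<gamma> / u r) + 3 / 5 * (\<beta>^3 / u r)"
          using u_pos[OF r] by (simp add: field_simps)
        also have "\<dots> \<le> - 107 / 10 * H r + 3 / 5 * (H r * coupling (w r))"
          using H_less_\<gamma>_div[OF r] H_coupling_lower[OF r] by simp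
        also have "\<dots> = H r * (- 107 / 10 + 3 / 5 * coupling (w r))" by (simp add: algebra_simps)
        also have "\<dots> < H r * (11 / 4 * hub_rate (w r) - w r)"
          by (intro mult_strict_left_mono hub_rate_lower(2) w_gt H_pos)
        finally show "- (m * (3 * \<beta>^3) / u r) < H r * (11 / 4 * hub_rate (w r) - w r)" .
      qed
      then show ?thesis by simp
    qed simp
    then have "exp (\<phi> s + 11 / 4 * ln (H s)) \<le> exp (11 / 4 * ln \<beta> + m * ln (u s))"
      by (simp add: \<phi>_0 H_0)
    then show ?thesis
      using \<beta>_pos u_pos[OF that] H_pos[of s] by (simp add: exp_add powr_def)
  qed
  define K where "K = \<beta> powr (- 1 / 4) / (4 * (m + 1))"
  have K1: "K * (m + 1) = \<beta> powr (- 1 / 4) / 4"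
    using m_pos by (simp add: K_def field_simps)
  define Lb where "Lb = (\<lambda>t. \<beta> powr (- 1 / 4) - K * (1 - u t powr (m + 1)))"
  have \<beta>_powr: "\<beta> powr (- 1 / 4) * \<beta>^3 = \<beta> powr (11 / 4)"
    using \<beta>_pos by (simp add: powr_mult_power)
  have "Lb 0 - Lb t < H 0 powr (- 1 / 4) - H t powr (- 1 / 4)"
  proof (rule DERIV_less_imp_diff_less[OF assms(1)])
    fix s :: real assume s: "s \<le> 0"
    have "(Lb has_real_derivative 0 - K * (0 - (m + 1) * u s powr (m + 1 - 1) * - (3 * \<beta>^3))) (at s)"
      unfolding Lb_def
      by (intro DERIV_diff DERIV_const DERIV_cmult s u_pos
          has_real_derivative_powr[THEN DERIV_chain2] DERIV_u)
    also have "0 - K * (0 - (m + 1) * u s powr (m + 1 - 1) * - (3 * \<beta>^3))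
        = - (3 * (K * (m + 1)) * (\<beta>^3 * u s powr m))"
      by (simp add: algebra_simps)
    also have "\<dots> = - (3 / 4 * (\<beta> powr (- 1 / 4) * \<beta>^3 * u s powr m))"
      unfolding K1 by simp
    finally show "(Lb has_real_derivative - (3 / 4 * (\<beta> powr (11 / 4) * u s powr m))) (at s)"
      unfolding \<beta>_powr .
    have "((\<lambda>t. H t powr (- 1 / 4)) has_real_derivative
        - 1 / 4 * H s powr (- 1 / 4 - 1) * ((H s)^2 * hub_rate (w s))) (at s)"
      using H_pos[of s]
      by (intro has_real_derivative_powr[THEN DERIV_chain2] DERIV_H) auto
    also have "- 1 / 4 * H s powr (- 1 / 4 - 1) * ((H s)^2 * hub_rate (w s))
        = - 1 / 4 * (H s powr (- 1 / 4 - 1) * (H s)^2) * hub_rate (w s)" by simp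
    also have "H s powr (- 1 / 4 - 1) * (H s)^2 = H s powr (3 / 4)"
      using H_pos[of s] by (simp add: powr_mult_power)
    finally show "((\<lambda>t. H t powr (- 1 / 4)) has_real_derivative
        - 1 / 4 * H s powr (3 / 4) * hub_rate (w s)) (at s)" .
    have "H s powr (3 / 4) * hub_rate (w s) < H s powr (3 / 4) * (3 * coupling (w s))"
      using H_pos[of s] by (intro mult_strict_left_mono hub_rate_upper(1) w_gt) auto
    also have "\<dots> = 3 * (exp (\<phi> s) * (H s powr (3 / 4) * (H s)^2))"
      unfolding constraint[symmetric] by simp
    also have "H s powr (3 / 4) * (H s)^2 = H s powr (11 / 4)"
      using H_pos[of s] by (simp add: powr_mult_power)
    also have "3 * (exp (\<phi> s) * H s powr (11 / 4)) \<le> 3 * (\<beta> powr (11 / 4) * u s powr m)"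
      using M[OF s] by simp
    finally show "- (3 / 4 * (\<beta> powr (11 / 4) * u s powr m)) < - 1 / 4 * H s powr (3 / 4) * hub_rate (w s)"
      by simp
  qed
  then have less: "H t powr (- 1 / 4) < L"
    by (simp add: Lb_def H_0 L_def K_def)
  have pos: "0 < H t powr (- 1 / 4)" using H_pos[of t] by simp
  have "inverse (L^4) < inverse ((H t powr (- 1 / 4))^4)"
    using less pos by (intro less_imp_inverse_less power_strict_mono) auto
  also have "(H t powr (- 1 / 4))^4 = inverse (H t)"
    by (subst powr_power) (use H_pos[of t] in \<open>auto simp: powr_minus\<close>)
  finally show "L powi (- 4) < H t" by (simp add: power_int_minus)
  have "0 < L" using less pos by linarith
  then show "0 < L powi (- 4)" by (simp add: power_int_minus)
qed

end

end

section \<open>Solution by quadrature\<close>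

lemma antiderivative_greaterThan:
  fixes f :: "real \<Rightarrow> real"
  assumes "\<And>x. a < x \<Longrightarrow> isCont f x" "a < c"
  obtains F where "\<And>x. a < x \<Longrightarrow> (F has_real_derivative f x) (at x)" "F c = k"
proof -
  obtain F where F: "\<And>x. a < x \<Longrightarrow> (F has_real_derivative f x) (at x)"
    using einterval_antiderivative[of "ereal a" \<infinity> f] assms
    by (auto simp: has_real_derivative_iff_has_vector_derivative)
  show thesis
    by (rule that[of "\<lambda>x. F x - F c + k"]) (auto intro!: derivative_eq_intros F)
qed

lemma antiderivative_real:
  fixes f :: "real \<Rightarrow> real"
  assumes "\<And>x. isCont f x"
  obtains F where "\<And>x. (F has_real_derivative f x) (at x)" "F c = k"
proof -
  obtain F where F: "\<And>x. (F has_real_derivative f x) (at x)"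
    using einterval_antiderivative[of "- \<infinity>" \<infinity> f] assms
    by (auto simp: has_real_derivative_iff_has_vector_derivative)
  show thesis
    by (rule that[of "\<lambda>x. F x - F c + k"]) (auto intro!: derivative_eq_intros F)
qed

lemma isCont_rates [continuous_intros]:
  "isCont hub_rate w" "isCont ratio_rate w"
  using hub_den_pos[of w] unfolding hub_rate_def[abs_def] ratio_rate_def[abs_def] hub_num_def hub_den_def
  by (auto intro!: continuous_intros)

text \<open>The data \<open>x(0) = \<beta>^2\<close> at \<open>w0\<close>, the Hubble parameter \<open>Hs\<close> and the time \<open>G\<close> as functions
  of the ratio \<open>w\<close>, and the inverse \<open>W\<close> of \<open>G\<close>.\<close>

locale quadrature =
  fixes \<beta> w0 :: real and Hs G W :: "real \<Rightarrow> real"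
  assumes w0: "sqrt 6 < w0" "coupling w0 = \<beta>^2"
    and Hs_pos: "\<And>w. sqrt 6 < w \<Longrightarrow> 0 < Hs w"
    and DERIV_Hs: "\<And>w. sqrt 6 < w \<Longrightarrow>
      (Hs has_real_derivative Hs w * (hub_rate w / ratio_rate w)) (at w)"
    and Hs_w0: "Hs w0 = \<beta>"
    and DERIV_G: "\<And>w. sqrt 6 < w \<Longrightarrow> (G has_real_derivative 1 / (Hs w * ratio_rate w)) (at w)"
    and G_w0: "G w0 = 0"
    and W_gt: "\<And>t. sqrt 6 < W t"
    and W_G: "\<And>w. sqrt 6 < w \<Longrightarrow> W (G w) = w"
    and G_W: "\<And>t. G (W t) = t"
begin

lemma W_0: "W 0 = w0"
  using W_G[OF w0(1)] by (simp add: G_w0)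

lemma DERIV_W: "(W has_real_derivative Hs (W t) * ratio_rate (W t)) (at t)"
proof -
  define D where "D = 1 / (Hs (W t) * ratio_rate (W t))"
  have "D \<noteq> 0"
    using Hs_pos[OF W_gt[of t]] ratio_rate_neg[OF W_gt[of t]] by (simp add: D_def)
  have "(W has_derivative (*) (inverse D)) (at (G (W t)))"
  proof (rule has_derivative_inverse_strong[where f = G and x = "W t" and S = "{sqrt 6<..}" and f' = "(*) D"])
    show "continuous_on {sqrt 6<..} G"
      using DERIV_G by (meson DERIV_isCont continuous_at_imp_continuous_on greaterThan_iff)
    show "(G has_derivative (*) D) (at (W t))"
      using DERIV_G[OF W_gt] by (simp add: has_field_derivative_def D_def)
    show "(*) D \<circ> (*) (inverse D) = id"
      using \<open>D \<noteq> 0\<close> by (simp add: fun_eq_iff)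
  qed (auto simp: W_gt W_G)
  then show ?thesis by (simp add: G_W has_field_derivative_def D_def)
qed

lemma DERIV_HsW:
  "((\<lambda>t. Hs (W t)) has_real_derivative (Hs (W t))^2 * hub_rate (W t)) (at t)"
proof -
  have "((\<lambda>t. Hs (W t)) has_real_derivative
      Hs (W t) * (hub_rate (W t) / ratio_rate (W t)) * (Hs (W t) * ratio_rate (W t))) (at t)"
    by (rule DERIV_chain2[OF DERIV_Hs[OF W_gt] DERIV_W])
  moreover have "Hs (W t) * (hub_rate (W t) / ratio_rate (W t)) * (Hs (W t) * ratio_rate (W t))
      = (Hs (W t))^2 * hub_rate (W t)"
    using ratio_rate_neg[OF W_gt[of t]] by (simp add: power2_eq_square)
  ultimately show ?thesis by simp
qed

text \<open>H / \<open>Hs w\<close> and \<open>G w\<close> - t are constant along the flow, with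
  values 1 and 0 at time 0. A convex J is allowed because H > 0 is at first known only on a segment
  starting at 0.\<close>

lemma unique:
  assumes J: "convex J" "0 \<in> J" "t \<in> J"
    and H: "\<And>t. t \<in> J \<Longrightarrow> 0 < H t" and w: "\<And>t. t \<in> J \<Longrightarrow> sqrt 6 < w t"
    and DH: "\<And>t. t \<in> J \<Longrightarrow> (H has_real_derivative (H t)^2 * hub_rate (w t)) (at t)"
    and Dw: "\<And>t. t \<in> J \<Longrightarrow> (w has_real_derivative H t * ratio_rate (w t)) (at t)"
    and init: "H 0 = \<beta>" "coupling (w 0) = \<beta>^2"
  shows "w t = W t" "H t = Hs (W t)"
proof -
  have w_0: "w 0 = w0"
    using coupling_strict_mono[of "w 0" w0] coupling_strict_mono[of w0 "w 0"] w[OF J(2)] w0 init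
    by (cases "w 0" w0 rule: linorder_cases) (auto simp: sqrt6_less_iff)
  have "((\<lambda>s. H s / Hs (w s)) has_real_derivative 0) (at s within J)" if "s \<in> J" for s
  proof -
    have "((\<lambda>s. Hs (w s)) has_real_derivative
        Hs (w s) * (hub_rate (w s) / ratio_rate (w s)) * (H s * ratio_rate (w s))) (at s)"
      by (rule DERIV_chain2[OF DERIV_Hs[OF w[OF that]] Dw[OF that]])
    moreover have "Hs (w s) * (hub_rate (w s) / ratio_rate (w s)) * (H s * ratio_rate (w s))
        = Hs (w s) * hub_rate (w s) * H s"
      using ratio_rate_neg[OF w[OF that]] by simp
    ultimately have D: "((\<lambda>s. Hs (w s)) has_real_derivative Hs (w s) * hub_rate (w s) * H s) (at s)"
      by simp
    have "((\<lambda>s. H s / Hs (w s)) has_real_derivative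
        ((H s)^2 * hub_rate (w s) * Hs (w s) - H s * (Hs (w s) * hub_rate (w s) * H s))
          / (Hs (w s) * Hs (w s))) (at s)"
      using Hs_pos[OF w[OF that]] by (intro DERIV_divide DH that D) auto
    moreover have "((H s)^2 * hub_rate (w s) * Hs (w s) - H s * (Hs (w s) * hub_rate (w s) * H s))
          / (Hs (w s) * Hs (w s)) = 0"
      by (simp add: power2_eq_square)
    ultimately show ?thesis by (metis has_field_derivative_at_within)
  qed
  from has_field_derivative_zero_constant[OF J(1) this]
  obtain c where c: "\<And>s. s \<in> J \<Longrightarrow> H s / Hs (w s) = c" by auto
  have "\<beta> > 0" using H[OF J(2)] init by simp
  then have "c = 1" using c[OF J(2)] by (simp add: w_0 init Hs_w0)
  then have Hw: "H s = Hs (w s)" if "s \<in> J" for s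
    using c[OF that] Hs_pos[OF w[OF that]] by (simp add: field_simps)
  have "((\<lambda>s. G (w s) - s) has_real_derivative 0) (at s within J)" if "s \<in> J" for s
  proof -
    have "((\<lambda>s. G (w s) - s) has_real_derivative
        1 / (Hs (w s) * ratio_rate (w s)) * (H s * ratio_rate (w s)) - 1) (at s)"
      by (intro DERIV_diff DERIV_ident DERIV_chain2[OF DERIV_G[OF w[OF that]] Dw[OF that]])
    moreover have "1 / (Hs (w s) * ratio_rate (w s)) * (H s * ratio_rate (w s)) - 1 = 0"
      using ratio_rate_neg[OF w[OF that]] Hs_pos[OF w[OF that]] Hw[OF that] by simp
    ultimately show ?thesis by (metis has_field_derivative_at_within)
  qed
  from has_field_derivative_zero_constant[OF J(1) this]
  obtain d where d: "\<And>s. s \<in> J \<Longrightarrow> G (w s) - s = d" by auto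
  have "d = 0" using d[OF J(2)] by (simp add: w_0 G_w0)
  then have "G (w t) = t" using d[OF J(3)] by simp
  then show wW: "w t = W t" using W_G[OF w[OF J(3)]] by simp
  show "H t = Hs (W t)" using Hw[OF J(3)] by (simp add: wW)
qed

end

section \<open>Divergence of the time integral at both ends\<close>

text \<open>\<open>Hs\<close> is bounded by a multiple of \<open>1 / w\<close>: it increases as long as \<open>hub_rate\<close> is negative,
  and \<open>w * Hs w\<close> decreases for large \<open>w\<close>.\<close>

lemma weighted_hubble_bounded:
  assumes Hs_pos: "\<And>w. sqrt 6 < w \<Longrightarrow> 0 < Hs w"
    and DERIV_Hs: "\<And>w. sqrt 6 < w \<Longrightarrow>
      (Hs has_real_derivative Hs w * (hub_rate w / ratio_rate w)) (at w)"
  obtains K :: real where "0 < K" "\<And>w. sqrt 6 < w \<Longrightarrow> Hs w * w \<le> K"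
proof -
  \<comment> \<open>\<open>hub_rate\<close> is negative up to 29/10 < 3, and from 16 on the quintic
    governing the sign of (w Hs)' is nonnegative; compactness covers the gap.\<close>
  have s6: "sqrt 6 < 29 / 10" unfolding sqrt6_less_iff by (simp add: power2_eq_square)
  have cont: "continuous_on {29 / 10..16} (\<lambda>w. Hs w * w)"
    using DERIV_Hs s6
    by (intro continuous_intros continuous_at_imp_continuous_on ballI)
      (meson DERIV_isCont atLeastAtMost_iff less_le_trans)
  obtain z where z: "z \<in> {29 / 10..16}" "\<And>w. w \<in> {29 / 10..16} \<Longrightarrow> Hs w * w \<le> Hs z * z"
    using continuous_attains_sup[OF compact_Icc _ cont] by auto
  have small: "Hs w * w \<le> Hs z * z" if w: "sqrt 6 < w" "w \<le> 29 / 10" for w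
  proof -
    have "Hs w \<le> Hs (29 / 10)"
    proof (rule DERIV_nonneg_imp_nondecreasing[OF w(2)])
      fix v assume v: "w \<le> v" "v \<le> 29 / 10"
      have "sqrt 6 < v" using v w by simp
      then have "0 \<le> Hs v * (hub_rate v / ratio_rate v)"
        using hub_rate_bounds_late(2)[of v] v ratio_rate_neg[of v] Hs_pos[of v]
        by (intro mult_nonneg_nonneg divide_nonpos_nonpos) auto
      then show "\<exists>y. (Hs has_real_derivative y) (at v) \<and> 0 \<le> y"
        using DERIV_Hs[OF \<open>sqrt 6 < v\<close>] by blast
    qed
    then have "Hs w * w \<le> Hs (29 / 10) * (29 / 10)"
      using w Hs_pos[OF s6] by (intro mult_mono) (auto simp: sqrt6_less_iff)
    also have "\<dots> \<le> Hs z * z" by (rule z(2)) simp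
    finally show ?thesis .
  qed
  have large: "Hs w * w \<le> Hs z * z" if "16 \<le> w" for w
  proof -
    have "Hs w * w \<le> Hs 16 * 16"
    proof (rule DERIV_nonpos_imp_nonincreasing[OF that])
      fix v :: real assume v: "16 \<le> v"
      have v6: "sqrt 6 < v" using v s6 by simp
      have num: "- (w * (w^2 - 6) * (w^3 + 10 * w^2 + 6 * w + 12)) + w * hub_num w
          = w * (w^5 - 15 * w^4 - 12 * w^3 + 12 * w^2 + 36 * w + 36)" for w :: real
        by (simp add: hub_num_def algebra_simps eval_nat_numeral)
      have "0 \<le> v^3 * (v * (v - 16) + (v - 16) + 4) + 12 * v^2 + 36 * v + 36"
        using v by (intro mult_nonneg_nonneg add_nonneg_nonneg) auto
      also have "\<dots> = v^5 - 15 * v^4 - 12 * v^3 + 12 * v^2 + 36 * v + 36"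
        by (simp add: algebra_simps eval_nat_numeral)
      finally have "0 \<le> v * (v^5 - 15 * v^4 - 12 * v^3 + 12 * v^2 + 36 * v + 36)"
        using v by (intro mult_nonneg_nonneg) auto
      moreover have "ratio_rate v + v * hub_rate v
          = v * (v^5 - 15 * v^4 - 12 * v^3 + 12 * v^2 + 36 * v + 36) / hub_den v"
        unfolding num[symmetric] by (simp add: ratio_rate_def hub_rate_def diff_divide_distrib)
      ultimately have "0 \<le> ratio_rate v + v * hub_rate v"
        using hub_den_pos[of v] by simp
      then have "(ratio_rate v + v * hub_rate v) / ratio_rate v \<le> 0"
        using ratio_rate_neg[OF v6] by (intro divide_nonneg_nonpos) auto
      then have "Hs v * ((ratio_rate v + v * hub_rate v) / ratio_rate v) \<le> 0"
        using Hs_pos[OF v6] by (intro mult_nonneg_nonpos) auto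
      moreover have "((\<lambda>w. Hs w * w) has_real_derivative
          Hs v * ((ratio_rate v + v * hub_rate v) / ratio_rate v)) (at v)"
        using ratio_rate_neg[OF v6]
        by (auto intro!: derivative_eq_intros DERIV_Hs[OF v6] simp: field_simps)
      ultimately show "\<exists>y. ((\<lambda>w. Hs w * w) has_real_derivative y) (at v) \<and> y \<le> 0" by blast
    qed
    also have "\<dots> \<le> Hs z * z" by (rule z(2)) simp
    finally show ?thesis .
  qed
  show thesis
  proof (rule that[of "Hs z * z"])
    have "sqrt 6 < z" using z(1) s6 by simp
    then show "0 < Hs z * z" using Hs_pos[of z] by (simp add: sqrt6_less_iff)
    fix w :: real assume "sqrt 6 < w"
    then show "Hs w * w \<le> Hs z * z"
      using small large z(2) by (cases "w \<le> 29 / 10"; cases "16 \<le> w") auto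
  qed
qed

text \<open>Together with w Hs <= K this bounds |w'| by a multiple of w - sqrt 6, whose reciprocal
  has a divergent integral at both ends. The constant is 2 * 9 / 4, from w + sqrt 6 <= 2 w, a cubic
  factor of at most 9 w^3, and \<open>hub_den w\<close> >= 4 w^4.\<close>

lemma ratio_rate_bound:
  assumes "sqrt 6 < w" shows "- ratio_rate w \<le> 9 / 2 * w * (w - sqrt 6)"
proof -
  have w: "0 < w" "6 < w^2" using assms by (auto simp: sqrt6_less_iff)
  have w2: "2 < w" using w power2_less_imp_less[of 2 w] by simp
  have fac: "w^2 - 6 = (w - sqrt 6) * (w + sqrt 6)"
    by (simp add: algebra_simps power2_eq_square)
  have "10 * w^2 + 6 * w + 12 \<le> 8 * w^3"
  proof -
    have "0 \<le> (w - 2) * (8 * w^2 + 6 * w + 6)" using w2 by simp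
    then show ?thesis by (simp add: algebra_simps power2_eq_square power3_eq_cube)
  qed
  then have "w * (w^2 - 6) * (w^3 + 10 * w^2 + 6 * w + 12)
      \<le> (w * ((w - sqrt 6) * (2 * w))) * (9 * w^3)"
    unfolding fac using w assms by (intro mult_mono mult_nonneg_nonneg) auto
  also have "\<dots> = (9 / 2 * w * (w - sqrt 6)) * (4 * w^4)"
    by (simp add: eval_nat_numeral)
  also have "\<dots> \<le> (9 / 2 * w * (w - sqrt 6)) * hub_den w"
  proof (rule mult_left_mono)
    have "hub_den w = 4 * w^4 + (w^2 - 6)^2"
      by (simp add: hub_den_def power2_eq_square power4_eq_xxxx algebra_simps)
    then show "4 * w^4 \<le> hub_den w" by simp
  qed (use w assms in simp)
  finally have "w * (w^2 - 6) * (w^3 + 10 * w^2 + 6 * w + 12) / hub_den w \<le> 9 / 2 * w * (w - sqrt 6)"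
    by (simp only: pos_divide_le_eq[OF hub_den_pos])
  then show ?thesis by (simp add: ratio_rate_def)
qed

lemma quadrature_exists:
  assumes "0 < \<beta>"
  shows "\<exists>w0 Hs G W. quadrature \<beta> w0 Hs G W"
proof -
  \<comment> \<open>The positive root of w^2 = 6 \<beta>^2 w + 6, that is, of
    \<open>coupling w = \<beta>^2\<close>.\<close>
  define w0 where "w0 = 3 * \<beta>^2 + sqrt (9 * \<beta>^4 + 6)"
  have r: "0 \<le> 9 * \<beta>^4 + 6" by simp
  have w0_pos: "0 < w0" unfolding w0_def using assms by (intro add_pos_nonneg) auto
  have "(sqrt (9 * \<beta>^4 + 6))^2 = 9 * \<beta>^4 + 6" using r by simp
  then have "(w0 - 3 * \<beta>^2)^2 = 9 * \<beta>^4 + 6" by (simp add: w0_def)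
  then have w0_sq: "w0^2 = 6 * \<beta>^2 * w0 + 6"
    by (simp add: algebra_simps power2_eq_square power4_eq_xxxx)
  have w0: "sqrt 6 < w0" "coupling w0 = \<beta>^2"
    using w0_pos w0_sq assms by (auto simp: sqrt6_less_iff coupling_def)
  have rr: "ratio_rate w \<noteq> 0" if "sqrt 6 < w" for w using ratio_rate_neg[OF that] by simp
  obtain L where L: "\<And>w. sqrt 6 < w \<Longrightarrow> (L has_real_derivative hub_rate w / ratio_rate w) (at w)"
      "L w0 = ln \<beta>"
    by (rule antiderivative_greaterThan[of "sqrt 6" "\<lambda>w. hub_rate w / ratio_rate w" w0 "ln \<beta>"])
      (auto intro!: continuous_intros w0 rr)
  define Hs where "Hs = (\<lambda>w. exp (L w))"
  have Hs_pos: "0 < Hs w" for w by (simp add: Hs_def)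
  have DHs: "(Hs has_real_derivative Hs w * (hub_rate w / ratio_rate w)) (at w)" if "sqrt 6 < w" for w
    unfolding Hs_def by (auto intro!: derivative_eq_intros L that)
  obtain K where K: "0 < K" "\<And>w. sqrt 6 < w \<Longrightarrow> Hs w * w \<le> K"
    using weighted_hubble_bounded[of Hs] Hs_pos DHs by blast
  have contHs: "isCont Hs w" if "sqrt 6 < w" for w using DHs[OF that] by (rule DERIV_isCont)
  have Hs0: "Hs w \<noteq> 0" for w using Hs_pos[of w] by simp
  obtain G where G: "\<And>w. sqrt 6 < w \<Longrightarrow> (G has_real_derivative 1 / (Hs w * ratio_rate w)) (at w)"
      "G w0 = 0"
    by (rule antiderivative_greaterThan[of "sqrt 6" "\<lambda>w. 1 / (Hs w * ratio_rate w)" w0 0])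
      (auto intro!: continuous_intros w0 contHs simp: Hs0 rr)
  have G_anti: "G w < G v" if "sqrt 6 < v" "v < w" for v w
  proof (rule DERIV_neg_imp_decreasing[OF that(2)])
    fix z assume "v \<le> z"
    then have z: "sqrt 6 < z" using that by simp
    then have "1 / (Hs z * ratio_rate z) < 0"
      using ratio_rate_neg[OF z] Hs_pos[of z] by (simp add: mult_pos_neg)
    then show "\<exists>y. (G has_real_derivative y) (at z) \<and> y < 0" using G(1)[OF z] by blast
  qed
  define \<kappa> where "\<kappa> = 1 / (9 / 2 * K)"
  have \<kappa>: "0 < \<kappa>" using K by (simp add: \<kappa>_def)
  \<comment> \<open>This is - G' >= \<kappa> / (w - sqrt 6) in integrated form; ln (w - sqrt 6) is
    unbounded in both directions, so G takes every real value.\<close>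
  have log_bound: "G w + \<kappa> * ln (w - sqrt 6) \<le> G v + \<kappa> * ln (v - sqrt 6)"
    if "sqrt 6 < v" "v \<le> w" for v w
  proof (rule DERIV_nonpos_imp_nonincreasing[OF that(2)])
    fix z assume "v \<le> z"
    then have z: "sqrt 6 < z" using that by simp
    have D: "((\<lambda>z. G z + \<kappa> * ln (z - sqrt 6)) has_real_derivative
        1 / (Hs z * ratio_rate z) + \<kappa> * (1 / (z - sqrt 6))) (at z)"
      using z by (auto intro!: derivative_eq_intros G)
    have "Hs z * (- ratio_rate z) \<le> Hs z * (9 / 2 * z * (z - sqrt 6))"
      using Hs_pos[of z] ratio_rate_bound[OF z] by (intro mult_left_mono) auto
    also have "\<dots> = 9 / 2 * (z - sqrt 6) * (Hs z * z)" by simp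
    also have "\<dots> \<le> 9 / 2 * (z - sqrt 6) * K"
      using K(2)[OF z] z by (intro mult_left_mono) auto
    finally have "Hs z * (- ratio_rate z) \<le> 9 / 2 * (z - sqrt 6) * K" .
    moreover have "0 < Hs z * (- ratio_rate z)"
      using Hs_pos[of z] ratio_rate_neg[OF z] by (intro mult_pos_pos) auto
    ultimately have "1 / (9 / 2 * (z - sqrt 6) * K) \<le> 1 / (Hs z * (- ratio_rate z))"
      using z K by (intro divide_left_mono mult_pos_pos[of "9 / 2 * (z - sqrt 6) * K"]) auto
    then have "1 / (Hs z * ratio_rate z) + \<kappa> * (1 / (z - sqrt 6)) \<le> 0"
      by (simp add: \<kappa>_def mult_ac)
    with D show "\<exists>y. ((\<lambda>z. G z + \<kappa> * ln (z - sqrt 6)) has_real_derivative y) (at z) \<and> y \<le> 0"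
      by blast
  qed
  have surj: "\<exists>w>sqrt 6. G w = t" for t
  proof -
    \<comment> \<open>At \<open>e c\<close> the function \<kappa> ln (w - sqrt 6) exceeds its value
      at w0 by c, so by \<open>log_bound\<close> the values of G at e(- |t|) and e(|t|) enclose
      t.\<close>
    define e where "e = (\<lambda>c. sqrt 6 + exp (ln (w0 - sqrt 6) + c / \<kappa>))"
    have e_gt: "sqrt 6 < e c" for c by (simp add: e_def)
    have e0: "e 0 = w0" using w0 by (simp add: e_def)
    have ln_e: "\<kappa> * ln (e c - sqrt 6) = \<kappa> * ln (w0 - sqrt 6) + c" for c
      using \<kappa> by (simp add: e_def field_simps)
    have e_mono: "e c \<le> e d" if "c \<le> d" for c d
      using that \<kappa> by (simp add: e_def divide_right_mono)
    have "e (- \<bar>t\<bar>) \<le> e 0" "e 0 \<le> e \<bar>t\<bar>" by (auto intro!: e_mono)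
    then have "G w0 + \<kappa> * ln (w0 - sqrt 6) \<le> G (e (- \<bar>t\<bar>)) + \<kappa> * ln (e (- \<bar>t\<bar>) - sqrt 6)"
      "G (e \<bar>t\<bar>) + \<kappa> * ln (e \<bar>t\<bar> - sqrt 6) \<le> G w0 + \<kappa> * ln (w0 - sqrt 6)"
      using log_bound[OF e_gt] log_bound[OF w0(1)] by (auto simp: e0)
    then have "\<bar>t\<bar> \<le> G (e (- \<bar>t\<bar>))" "G (e \<bar>t\<bar>) \<le> - \<bar>t\<bar>"
      unfolding ln_e by (auto simp: G(2))
    then have "G (e \<bar>t\<bar>) \<le> t" "t \<le> G (e (- \<bar>t\<bar>))" by auto
    moreover have "\<forall>x. e (- \<bar>t\<bar>) \<le> x \<and> x \<le> e \<bar>t\<bar> \<longrightarrow> isCont G x"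
      using G(1) e_gt by (meson DERIV_isCont less_le_trans)
    ultimately obtain w where "e (- \<bar>t\<bar>) \<le> w" "G w = t"
      using IVT2[of G "e \<bar>t\<bar>" t "e (- \<bar>t\<bar>)"] e_mono[of "- \<bar>t\<bar>" "\<bar>t\<bar>"] by auto
    then show ?thesis using e_gt less_le_trans by blast
  qed
  have inj: "v = w" if "sqrt 6 < v" "sqrt 6 < w" "G v = G w" for v w
    using G_anti[of v w] G_anti[of w v] that by (cases v w rule: linorder_cases) auto
  define W where "W t = (SOME w. sqrt 6 < w \<and> G w = t)" for t
  have W: "sqrt 6 < W t \<and> G (W t) = t" for t
    unfolding W_def by (rule someI_ex) (use surj in auto)
  have "quadrature \<beta> w0 Hs G W"
    by unfold_locales (use w0 Hs_pos DHs G W inj L(2) assms in \<open>auto simp: Hs_def\<close>)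
  then show ?thesis by blast
qed

section \<open>Global solutions\<close>

lemma C2_realD:
  assumes "C2_real f"
  shows "(f has_real_derivative deriv f t) (at t)"
    and "(deriv f has_real_derivative deriv (deriv f) t) (at t)"
  using assms unfolding C2_real_def C1_differentiable_on_eq
  by (auto simp: DERIV_deriv_iff_real_differentiable)

lemma C2_realI:
  assumes "\<And>t. (f has_real_derivative f' t) (at t)"
    and "\<And>t. (f' has_real_derivative f'' t) (at t)"
    and "continuous_on UNIV f''"
  shows "C2_real f"
proof -
  have "deriv f = f'" using DERIV_imp_deriv[OF assms(1)] by (rule ext)
  moreover have "continuous_on UNIV f'"
    using assms(2) by (meson DERIV_isCont continuous_at_imp_continuous_on)
  ultimately show ?thesis
    using assms unfolding C2_real_def C1_differentiable_on_def has_real_derivative_iff_has_vector_derivative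
    by auto
qed

lemma DERIV_coupling:
  assumes "w \<noteq> 0"
  shows "(coupling has_real_derivative (w^2 + 6) / (6 * w^2)) (at w)"
proof -
  have "(coupling has_real_derivative (2 * w * (6 * w) - (w^2 - 6) * 6) / (6 * w * (6 * w))) (at w)"
    unfolding coupling_def[abs_def] using assms by (auto intro!: derivative_eq_intros)
  moreover have "(2 * w * (6 * w) - (w^2 - 6) * 6) / (6 * w * (6 * w)) = (w^2 + 6) / (6 * w^2)"
    using assms by (simp add: field_simps power2_eq_square)
  ultimately show ?thesis by simp
qed

text \<open>The evolution preserves the constraint: by the chain rule the left side is x' / H, and 2
  h - w on the right is the logarithmic derivative of exp \<phi> H^2 divided by H.\<close>

lemma coupling_rate:
  assumes "sqrt 6 < w"
  shows "(w^2 + 6) / (6 * w^2) * ratio_rate w = coupling w * (2 * hub_rate w - w)"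
proof -
  have w: "w \<noteq> 0" using assms by (auto simp: sqrt6_less_iff)
  have "(w^2 + 6) * - (w * (w^2 - 6) * (w^3 + 10 * w^2 + 6 * w + 12))
      = w * (w^2 - 6) * (2 * hub_num w - w * hub_den w)"
    by (simp add: hub_num_def hub_den_def algebra_simps eval_nat_numeral)
  then have "(w^2 + 6) * ratio_rate w = w * (w^2 - 6) * (2 * hub_num w - w * hub_den w) / hub_den w"
    by (simp only: ratio_rate_def times_divide_eq_right)
  also have "\<dots> = w * (w^2 - 6) * (2 * hub_rate w - w)"
    using hub_den_pos[of w] by (simp add: hub_rate_def field_simps)
  finally have "(w^2 + 6) * ratio_rate w / (6 * w^2) = w * (w^2 - 6) * (2 * hub_rate w - w) / (6 * w^2)"
    by simp
  then show ?thesis using w by (simp add: coupling_def power2_eq_square)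
qed

context quadrature
begin

text \<open>\<phi> is read off from the constraint instead of being integrated; \<phi>' = - w H then
  follows from \<open>coupling_rate\<close>.\<close>

lemma solution_exists:
  assumes "0 < a0" and N: "\<And>t. (N has_real_derivative Hs (W t)) (at t)" "N 0 = 0"
  shows "global_edgb_solution a0 \<beta> (\<lambda>t. a0 * exp (N t)) (\<lambda>t. ln (coupling (W t) / (Hs (W t))^2))"
proof -
  define H where "H t = Hs (W t)" for t
  define a where "a = (\<lambda>t. a0 * exp (N t))"
  define \<phi> where "\<phi> = (\<lambda>t. ln (coupling (W t) / (H t)^2))"
  define H1 where "H1 = (\<lambda>t. (H t)^2 * hub_rate (W t))"
  define p1 where "p1 = (\<lambda>t. - (W t * ((H t)^2 * hub_rate (W t))) - (H t)^2 * ratio_rate (W t))"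
  have H_pos: "0 < H t" for t using Hs_pos[OF W_gt] by (simp add: H_def)
  have x_pos: "0 < coupling (W t)" for t using coupling_pos[OF W_gt] .
  have W_pos: "0 < W t" for t using W_gt[of t] by (simp add: sqrt6_less_iff)
  have DH: "(H has_real_derivative H1 t) (at t)" for t
    using DERIV_HsW by (simp add: H_def[abs_def] H1_def)
  have DW: "(W has_real_derivative H t * ratio_rate (W t)) (at t)" for t
    using DERIV_W by (simp add: H_def)
  have contW: "isCont W t" and contH: "isCont H t" for t
    using DW DH by (auto intro: DERIV_isCont)
  have cont: "isCont (\<lambda>t. hub_rate (W t)) t" "isCont (\<lambda>t. ratio_rate (W t)) t" for t
    using isCont_o2[OF contW] isCont_rates by blast+
  have DN: "(N has_real_derivative H t) (at t)" for t using N by (simp add: H_def)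
  have Da: "(a has_real_derivative a t * H t) (at t)" for t
    unfolding a_def by (auto intro!: derivative_eq_intros DN)
  have Da1: "((\<lambda>t. a t * H t) has_real_derivative a t * ((H t)^2 + H1 t)) (at t)" for t
    by (auto intro!: derivative_eq_intros Da DH simp: algebra_simps power2_eq_square)
  have a_pos: "0 < a t" for t using assms(1) by (simp add: a_def)
  have hub: "hubble a = H"
    using DERIV_imp_deriv[OF Da] a_pos by (auto simp: hubble_def fun_eq_iff less_imp_neq[symmetric])
  have D\<phi>: "(\<phi> has_real_derivative - (W t * H t)) (at t)" for t
  proof -
    have Dx: "((\<lambda>t. coupling (W t)) has_real_derivative
        coupling (W t) * (H t * (2 * hub_rate (W t) - W t))) (at t)"
    proof -
      have "((\<lambda>t. coupling (W t)) has_real_derivative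
          ((W t)^2 + 6) / (6 * (W t)^2) * (H t * ratio_rate (W t))) (at t)"
        using W_pos[of t] by (intro DERIV_chain2[OF DERIV_coupling DW]) auto
      moreover have "((W t)^2 + 6) / (6 * (W t)^2) * (H t * ratio_rate (W t))
          = H t * (((W t)^2 + 6) / (6 * (W t)^2) * ratio_rate (W t))" by simp
      ultimately show ?thesis by (simp only: coupling_rate[OF W_gt] mult.left_commute)
    qed
    have "((\<lambda>t. ln (coupling (W t)) - 2 * ln (H t)) has_real_derivative
        coupling (W t) * (H t * (2 * hub_rate (W t) - W t)) / coupling (W t) - 2 * (H1 t / H t)) (at t)"
      using x_pos[of t] H_pos[of t] by (auto intro!: derivative_eq_intros Dx DH)
    moreover have "coupling (W t) * (H t * (2 * hub_rate (W t) - W t)) / coupling (W t) - 2 * (H1 t / H t)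
        = - (W t * H t)"
      using x_pos[of t] H_pos[of t]
      by (simp add: H1_def power2_eq_square) (simp add: algebra_simps)
    moreover have "\<phi> = (\<lambda>t. ln (coupling (W t)) - 2 * ln (H t))"
    proof
      fix t
      show "\<phi> t = ln (coupling (W t)) - 2 * ln (H t)"
        using x_pos[of t] H_pos[of t] by (simp add: \<phi>_def ln_div ln_realpow)
    qed
    ultimately show ?thesis by simp
  qed
  have Dp: "((\<lambda>t. - (W t * H t)) has_real_derivative p1 t) (at t)" for t
    by (auto intro!: derivative_eq_intros DW DH simp: p1_def H1_def algebra_simps power2_eq_square)
  have "C2_real a"
    by (rule C2_realI[OF Da Da1])
      (auto intro!: continuous_at_imp_continuous_on continuous_intros cont contH DERIV_isCont[OF Da] simp: H1_def)
  moreover have "C2_real \<phi>"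
    by (rule C2_realI[OF D\<phi> Dp])
      (auto intro!: continuous_at_imp_continuous_on continuous_intros cont contH contW simp: p1_def)
  moreover have d\<phi>: "deriv \<phi> = (\<lambda>t. - (W t * H t))"
    using DERIV_imp_deriv[OF D\<phi>] by (rule ext)
  moreover have "edgb_flrw_equations a \<phi> t" for t
  proof -
    have "exp (\<phi> t) * (H t)^2 = coupling (W t)"
      using x_pos[of t] H_pos[of t] by (simp add: \<phi>_def)
    note eqs = equations_of_reduced[OF H_pos W_pos this]
    have "deriv H t = (H t)^2 * hub_rate (W t)"
      using DERIV_imp_deriv[OF DH] by (simp add: H1_def)
    moreover have "deriv (\<lambda>t. - (W t * H t)) t
        = - (W t * ((H t)^2 * hub_rate (W t))) - (H t)^2 * ratio_rate (W t)"
      using DERIV_imp_deriv[OF Dp] by (simp add: p1_def)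
    ultimately show ?thesis
      unfolding edgb_flrw_equations_def Let_def hub d\<phi> using eqs by simp
  qed
  moreover have "a 0 = a0" by (simp add: a_def N)
  moreover have "hubble a 0 = \<beta>" by (simp add: hub H_def W_0 Hs_w0)
  moreover have "\<phi> 0 = 0" using H_pos[of 0] by (simp add: \<phi>_def H_def W_0 Hs_w0 w0)
  moreover have "0 < W 0 * H 0" using W_pos H_pos by simp
  ultimately have "global_edgb_solution a0 \<beta> a \<phi>"
    using a_pos by (simp add: global_edgb_solution_def)
  then show ?thesis by (simp add: a_def \<phi>_def H_def)
qed

text \<open>The substance is that H stays positive: the reduced system is available only where H > 0
  and \<phi>' < 0, and both signs are given at 0 alone.\<close>

lemma solution_reduced:
  assumes sol: "global_edgb_solution a0 \<beta> a \<phi>" and "0 < \<beta>"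
  defines "w \<equiv> \<lambda>t. - deriv \<phi> t / hubble a t"
  shows "hubble a t = Hs (W t)" "w t = W t" "0 < hubble a t" "deriv \<phi> t < 0"
    and "(hubble a has_real_derivative (hubble a t)^2 * hub_rate (w t)) (at t)"
    and "(w has_real_derivative hubble a t * ratio_rate (w t)) (at t)"
    and "exp (\<phi> t) * (hubble a t)^2 = coupling (w t)"
proof -
  define H where "H = hubble a"
  define p where "p = deriv \<phi>"
  have a: "C2_real a" "\<And>t. 0 < a t" and "C2_real \<phi>"
    and eqs: "\<And>t. edgb_flrw_equations a \<phi> t"
    and init: "H 0 = \<beta>" "\<phi> 0 = 0" "p 0 < 0"
    using sol by (auto simp: global_edgb_solution_def H_def p_def)
  have DH: "(H has_real_derivative deriv H t) (at t)" for t
  proof -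
    have "(\<lambda>t. deriv a t / a t) field_differentiable at t"
      unfolding field_differentiable_def
      using DERIV_divide[OF C2_realD(2)[OF a(1)] C2_realD(1)[OF a(1)], of t] a(2)[of t]
      by (metis less_irrefl)
    then show ?thesis
      unfolding H_def hubble_def[abs_def] by (simp add: field_differentiable_derivI)
  qed
  have Dp: "(p has_real_derivative deriv p t) (at t)" for t
    unfolding p_def by (rule C2_realD(2)[OF \<open>C2_real \<phi>\<close>])
  have contH: "isCont H t" and contp: "isCont p t" for t
    using DH Dp by (auto intro: DERIV_isCont)
  have eqs': "3 * (H t)^2 - 3 * exp (\<phi> t) * p t * (H t)^3 = (p t)^2 / 2"
    "2 * deriv H t + 3 * (H t)^2 = - ((p t)^2 / 2) + 2 * exp (\<phi> t) * p t * H t * ((H t)^2 + deriv H t)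
      + exp (\<phi> t) * (H t)^2 * ((p t)^2 + deriv p t)"
    "deriv p t = - 3 * H t * p t - 3 * exp (\<phi> t) * (H t)^2 * ((H t)^2 + deriv H t)" for t
    using eqs[of t] unfolding edgb_flrw_equations_def Let_def H_def p_def by auto
  \<comment> \<open>At a zero of p the constraint reads 3 H^2 = 0, so p keeps its sign on an
    interval where H > 0.\<close>
  have p_neg: "p s < 0" if J: "convex J" "0 \<in> J" "\<And>t. t \<in> J \<Longrightarrow> 0 < H t" "s \<in> J" for J s
  proof (rule ccontr)
    assume "\<not> p s < 0"
    have "connected (p ` J)"
      using contp J(1) by (intro connected_continuous_image continuous_at_imp_continuous_on convex_connected) auto
    then have "0 \<in> p ` J"
      using J init(3) \<open>\<not> p s < 0\<close> connected_iff_interval[of "p ` J"] by (force simp: not_less)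
    then obtain r where "r \<in> J" "p r = 0" by auto
    then show False using J(3)[of r] eqs'(1)[of r] by simp
  qed
  have reduced: "sqrt 6 < w s" "exp (\<phi> s) * (H s)^2 = coupling (w s)"
      "(H has_real_derivative (H s)^2 * hub_rate (w s)) (at s)"
      "(w has_real_derivative H s * ratio_rate (w s)) (at s)"
    if "0 < H s" "p s < 0" for s
  proof -
    note red = reduced_equations[OF exp_gt_zero[of "\<phi> s"] that eqs'[of s]]
    have w: "w s = - p s / H s" by (simp add: w_def p_def H_def)
    show "sqrt 6 < w s" "exp (\<phi> s) * (H s)^2 = coupling (w s)"
      unfolding w by (fact red)+
    show "(H has_real_derivative (H s)^2 * hub_rate (w s)) (at s)"
      using DH[of s] unfolding w red(3)[symmetric] .
    have "((\<lambda>s. - p s / H s) has_real_derivative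
        ((- deriv p s) * H s - (- p s) * deriv H s) / (H s * H s)) (at s)"
      using that by (intro DERIV_divide DERIV_minus Dp DH) auto
    moreover have "((- deriv p s) * H s - (- p s) * deriv H s) / (H s * H s)
        = - (deriv p s * H s - p s * deriv H s) / (H s)^2"
      by (simp add: power2_eq_square)
    ultimately have "((\<lambda>s. - p s / H s) has_real_derivative H s * ratio_rate (- p s / H s)) (at s)"
      by (simp only: red(4))
    then show "(w has_real_derivative H s * ratio_rate (w s)) (at s)"
      by (simp only: w_def p_def H_def)
  qed
  have on_J: "w s = W s" "H s = Hs (W s)"
    if J: "convex J" "0 \<in> J" "\<And>t. t \<in> J \<Longrightarrow> 0 < H t" "s \<in> J" for J s
  proof -
    have neg: "p t < 0" if "t \<in> J" for t using p_neg[OF J(1-3) that] .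
    have "coupling (w 0) = \<beta>^2"
      using reduced(2)[OF J(3)[OF J(2)] neg[OF J(2)]] init by simp
    then show "w s = W s" "H s = Hs (W s)"
      using unique[of J s H w] J init(1) reduced(1,3,4)[OF J(3) neg] by blast+
  qed
  have H_pos: "0 < H s" for s
  proof (rule ccontr)
    assume "\<not> 0 < H s"
    \<comment> \<open>Times are written as l s with l in [0, 1], which treats both signs of s at
      once; the least element of S marks the first failure of H > 0 on the way from 0 to s.\<close>
    define S where "S = {l \<in> {0..1::real}. H (l * s) \<le> 0}"
    have contHU: "continuous_on UNIV H" using contH by (intro continuous_at_imp_continuous_on) auto
    have contHl: "continuous_on A (\<lambda>l. H (l * s))" for A
      by (rule continuous_on_compose2[OF contHU]) (auto intro!: continuous_intros)
    have "closed S"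
      unfolding S_def by (intro continuous_on_closed_Collect_le contHl continuous_intros closed_atLeastAtMost)
    moreover have "bounded S"
      by (rule bounded_subset[of "{0..1}"]) (auto simp: S_def)
    moreover have "1 \<in> S" using \<open>\<not> 0 < H s\<close> by (simp add: S_def)
    ultimately obtain l where l: "l \<in> S" and min: "\<And>k. k \<in> S \<Longrightarrow> l \<le> k"
      using compact_attains_inf[of S] compact_eq_bounded_closed by blast
    have "l \<noteq> 0" using l init \<open>0 < \<beta>\<close> by (auto simp: S_def)
    then have l01: "0 < l" "l \<le> 1" using l by (auto simp: S_def)
    define J where "J = (\<lambda>k. k * s) ` {0..<l}"
    have J: "convex J" "0 \<in> J"
      using l01 convex_scaled[of "{0..<l}" s]
      by (auto simp: J_def intro!: image_eqI[of _ _ 0])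
    have "0 < H t" if tJ: "t \<in> J" for t
    proof -
      obtain k where k: "t = k * s" "0 \<le> k" "k < l" using tJ unfolding J_def by fastforce
      then have "k \<notin> S" using min[of k] by auto
      then show ?thesis using k l01 by (simp add: S_def)
    qed
    then have "H t = Hs (W t)" if "t \<in> J" for t
      using on_J(2)[OF J _ that] by blast
    then have eq: "H (k * s) = Hs (W (k * s))" if "k \<in> {0..<l}" for k
      using that unfolding J_def by blast
    \<comment> \<open>The identity of H with Hs(W), known for parameters below l, passes to l by
      continuity, and Hs(W) is positive there.\<close>
    have "continuous_on UNIV (\<lambda>t. Hs (W t))"
      using DERIV_isCont[OF DERIV_HsW] by (intro continuous_at_imp_continuous_on) auto
    then have "continuous_on UNIV (\<lambda>k. Hs (W (k * s)))"
      by (rule continuous_on_compose2) (auto intro!: continuous_intros)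
    then have "closed {k. H (k * s) = Hs (W (k * s))}"
      by (intro closed_Collect_eq contHl)
    then have "closure {0..<l} \<subseteq> {k. H (k * s) = Hs (W (k * s))}"
      using eq by (intro closure_minimal) auto
    then have "{0..l} \<subseteq> {k. H (k * s) = Hs (W (k * s))}"
      using l01 by simp
    then have "l \<in> {k. H (k * s) = Hs (W (k * s))}"
      using l01 by (meson atLeastAtMost_iff less_imp_le order_refl subsetD)
    then have "H (l * s) = Hs (W (l * s))" by simp
    then show False using l Hs_pos[OF W_gt[of "l * s"]] by (simp add: S_def)
  qed
  have neg: "p s < 0" for s by (rule p_neg[of UNIV]) (simp_all add: H_pos)
  show "hubble a t = Hs (W t)"
    unfolding H_def[symmetric] by (rule on_J(2)[of UNIV]) (simp_all add: H_pos)
  show "w t = W t" by (rule on_J(1)[of UNIV]) (simp_all add: H_pos)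
  show "0 < hubble a t" unfolding H_def[symmetric] by (rule H_pos)
  show "deriv \<phi> t < 0" unfolding p_def[symmetric] by (rule neg)
  show "(hubble a has_real_derivative (hubble a t)^2 * hub_rate (w t)) (at t)"
    unfolding H_def[symmetric] by (rule reduced(3)[OF H_pos neg])
  show "(w has_real_derivative hubble a t * ratio_rate (w t)) (at t)"
    unfolding H_def[symmetric] by (rule reduced(4)[OF H_pos neg])
  show "exp (\<phi> t) * (hubble a t)^2 = coupling (w t)"
    unfolding H_def[symmetric] by (rule reduced(2)[OF H_pos neg])
qed

lemma solution_reduced_flow:
  assumes sol: "global_edgb_solution a0 \<beta> a \<phi>" and "0 < \<beta>" "\<beta> < sqrt 6 / 6"
  shows "reduced_flow \<beta> (hubble a) \<phi> (\<lambda>t. - deriv \<phi> t / hubble a t)"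
proof
  note red = solution_reduced[OF sol \<open>0 < \<beta>\<close>]
  fix t
  show "sqrt 6 < - deriv \<phi> t / hubble a t" unfolding red(2) by (rule W_gt)
  have "C2_real \<phi>" using sol by (simp add: global_edgb_solution_def)
  then show "(\<phi> has_real_derivative - (- deriv \<phi> t / hubble a t * hubble a t)) (at t)"
    using C2_realD(1)[of \<phi> t] red(3)[of t] by simp
  show "(hubble a has_real_derivative (hubble a t)^2 * hub_rate (- deriv \<phi> t / hubble a t)) (at t)"
    by (rule red(5))
  show "((\<lambda>t. - deriv \<phi> t / hubble a t) has_real_derivative
      hubble a t * ratio_rate (- deriv \<phi> t / hubble a t)) (at t)"
    by (rule red(6))
  show "exp (\<phi> t) * (hubble a t)^2 = coupling (- deriv \<phi> t / hubble a t)"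
    by (rule red(7))
  show "0 < hubble a t" by (rule red(3))
next
  show "hubble a 0 = \<beta>" "\<phi> 0 = 0" using sol by (simp_all add: global_edgb_solution_def)
qed (fact assms)+

text \<open>Hs and W determine \<phi> through the constraint, and a because a exp (- N) has
  derivative zero.\<close>

lemma unique_solution:
  assumes "0 < a0" "0 < \<beta>"
  shows "\<exists>!p. global_edgb_solution a0 \<beta> (fst p) (snd p)"
proof -
  obtain N where N: "\<And>t. (N has_real_derivative Hs (W t)) (at t)" "N 0 = 0"
    by (rule antiderivative_real[of "\<lambda>t. Hs (W t)" 0 0, OF DERIV_isCont[OF DERIV_HsW]]) auto
  show ?thesis
  proof (rule ex1I)
    let ?p = "(\<lambda>t. a0 * exp (N t), \<lambda>t. ln (coupling (W t) / (Hs (W t))^2))"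
    show "global_edgb_solution a0 \<beta> (fst ?p) (snd ?p)"
      using solution_exists[OF assms(1) N] by (simp only: fst_conv snd_conv)
    fix p assume "global_edgb_solution a0 \<beta> (fst p) (snd p)"
    then obtain a \<phi> where p: "p = (a, \<phi>)" and sol: "global_edgb_solution a0 \<beta> a \<phi>"
      by (cases p) simp
    note red = solution_reduced[OF sol assms(2)]
    have "\<phi> t = ln (coupling (W t) / (Hs (W t))^2)" for t
    proof -
      have "exp (\<phi> t) * (Hs (W t))^2 = coupling (W t)"
        using red(7)[of t] by (simp only: red(2)) (simp only: red(1))
      then have "exp (\<phi> t) = coupling (W t) / (Hs (W t))^2"
        using Hs_pos[OF W_gt[of t]] by (simp add: field_simps)
      then show ?thesis by (metis ln_exp)
    qed
    moreover have "a t = a0 * exp (N t)" for t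
    proof -
      have a: "C2_real a" "\<And>t. 0 < a t" "a 0 = a0"
        using sol by (auto simp: global_edgb_solution_def)
      have "((\<lambda>t. a t * exp (- N t)) has_real_derivative 0) (at s)" for s
      proof -
        have "deriv a s = a s * Hs (W s)"
          using red(1)[of s] a(2)[of s] by (simp add: hubble_def field_simps)
        then have "(a has_real_derivative a s * Hs (W s)) (at s)"
          using C2_realD(1)[OF a(1)] by metis
        then show ?thesis
          by (auto intro!: derivative_eq_intros N)
      qed
      then have "a t * exp (- N t) = a 0 * exp (- N 0)"
        by (intro DERIV_isconst_all) auto
      then show ?thesis by (simp add: N a exp_minus field_simps)
    qed
    ultimately show "p = ?p" by (auto simp: p)
  qed
qed

end

text \<open>The constants enter through \<open>sqrt 3 \<le> \<gamma>\<close>, 0 < \<theta> <=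
  \<beta>^2 and a linear relation between m and \<gamma>. Here \<gamma> is the positive root of
  \<gamma>^2 = 3 \<beta>^3 \<gamma> + 3.\<close>

theorem theorem1p1:
  fixes a0 \<beta> \<gamma> \<theta> m :: real
  assumes "0 < a0"
    and "0 < \<beta>" and "\<beta> < sqrt 6 / 6"
    and "\<gamma> = (3 * \<beta>^3 + sqrt (9 * \<beta>^6 + 12)) / 2"
    and "\<theta> = 2 * (9 * \<beta>^6 + sqrt (9 * \<beta>^6 + 12) * \<beta>^3) / (sqrt (9 * \<beta>^6 + 12) + 3 * \<beta>^3)^2"
    and "m = (107 * sqrt (9 * \<beta>^6 + 12) + 309 * \<beta>^3) / (60 * \<beta>^3)"
  shows "(\<exists>!p. global_edgb_solution a0 \<beta> (fst p) (snd p)) \<and>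
    (\<forall>a \<phi>. global_edgb_solution a0 \<beta> a \<phi> \<longrightarrow>
      (\<forall>t<0.
        hubble a t < min
          ((exp (6 * \<gamma> * t) * (1 / \<beta>^2 - 4 * \<beta> / (5 * \<gamma>) + 2 * \<theta> / (15 * \<gamma>^2))
             - 2 * (- 6 * \<beta> * \<gamma> + \<theta> + 6 * \<gamma> * \<theta> * t) / (15 * \<gamma>^2)) powr (- 1 / 2))
          (\<gamma> / (- 3 * \<beta>^3 * t + 1)) \<and>
        hubble a t > (\<beta> powr (- 1 / 4) - \<beta> powr (- 1 / 4) / (4 * (m + 1))
             * (1 - (- 3 * \<beta>^3 * t + 1) powr (m + 1))) powi (- 4) \<and>
        (\<beta> powr (- 1 / 4) - \<beta> powr (- 1 / 4) / (4 * (m + 1))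
             * (1 - (- 3 * \<beta>^3 * t + 1) powr (m + 1))) powi (- 4) > 0 \<and>
        ln ((- 3 * \<beta>^3 * t + 1)^2) < \<phi> t \<and>
        \<phi> t < sqrt 6 * \<gamma> / (3 * \<beta>^3) * ln (- 3 * \<beta>^3 * t + 1)
             + 2 * \<beta>^3 / (4 * \<gamma> + \<beta>^3)
               * ((- 3 * \<beta>^3 * t + 1) powr ((4 * \<gamma> + \<beta>^3) / \<beta>^3) - 1)) \<and>
      (\<forall>t>0.
        1 / (5 * t + 1 / \<beta>) < hubble a t \<and>
        hubble a t < 1 / (1 / 2 * t + 1 / \<beta>) \<and>
        - (12 * \<beta>^2 + 2 * sqrt 6) * ln (1 / 2 * \<beta> * t + 1) < \<phi> t \<and>
        \<phi> t < - ln (1 + 3 / 5 * (\<beta>^2 - 1 / (5 * t + 1 / \<beta>)^2))))"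
proof -
  define b S where "b = \<beta>^3" and "S = sqrt (9 * \<beta>^6 + 12)"
  have b: "0 < b" using assms(2) by (simp add: b_def)
  have b6: "\<beta>^6 = b^2" by (simp add: b_def power_mult[symmetric])
  have "sqrt 12 \<le> S" unfolding S_def by simp
  moreover have "sqrt 12 = 2 * sqrt 3"
    using real_sqrt_mult[of 4 3] by simp
  ultimately have S: "2 * sqrt 3 \<le> S" by simp
  have sqrt3: "3 / 2 \<le> sqrt 3"
    by (rule real_le_rsqrt) (simp add: power2_eq_square)
  have \<gamma>_eq: "\<gamma> = (3 * b + S) / 2" using assms(4) by (simp add: b_def S_def)
  have \<gamma>: "sqrt 3 \<le> \<gamma>" using S b by (simp add: \<gamma>_eq)
  have \<theta>_eq: "\<theta> = 2 * (9 * b^2 + S * b) / (S + 3 * b)^2"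
    using assms(5) by (simp only: b_def[symmetric] S_def[symmetric]) (simp only: b6)
  have S3: "3 \<le> S" using S sqrt3 by linarith
  have \<theta>_pos: "0 < \<theta>"
    unfolding \<theta>_eq using b S3 by (intro divide_pos_pos mult_pos_pos add_pos_pos zero_less_power) auto
  \<comment> \<open>S + 3 b >= 3 absorbs the factor 3 and gives \<theta> <= 2 \<beta>^3; then 2
    \<beta> < 1 yields \<theta> <= \<beta>^2.\<close>
  have "2 * (9 * b^2 + S * b) \<le> 2 * b * (S + 3 * b)^2"
  proof -
    have "9 * b^2 + S * b \<le> b * (3 * (S + 3 * b))"
      using b S3 by (simp add: algebra_simps power2_eq_square)
    also have "\<dots> \<le> b * ((S + 3 * b) * (S + 3 * b))"
      using b S3 by (intro mult_left_mono mult_right_mono) auto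
    finally show ?thesis by (simp add: power2_eq_square)
  qed
  then have "\<theta> \<le> 2 * b"
    unfolding \<theta>_eq using b S3 by (subst pos_divide_le_eq) auto
  moreover have "2 * b \<le> \<beta>^2"
  proof -
    have "sqrt 6 < 3" by (rule real_less_lsqrt) auto
    then have "\<beta>^2 * (2 * \<beta>) \<le> \<beta>^2 * 1" using assms by (intro mult_left_mono) auto
    then show ?thesis by (simp add: b_def power2_eq_square power3_eq_cube)
  qed
  ultimately have \<theta>_le: "\<theta> \<le> \<beta>^2" by simp
  have m: "3 * \<beta>^3 * m = 107 / 10 * \<gamma> - 3 / 5 * \<beta>^3"
  proof -
    have "m = (107 * S + 309 * b) / (60 * b)" using assms(6) by (simp add: b_def S_def)
    then show ?thesis unfolding b_def[symmetric] \<gamma>_eq using b by (simp add: field_simps)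
  qed
  obtain w0 Hs G W where "quadrature \<beta> w0 Hs G W"
    using quadrature_exists[OF assms(2)] by blast
  then interpret quadrature \<beta> w0 Hs G W .
  show ?thesis
  proof (intro conjI allI impI)
    show "\<exists>!p. global_edgb_solution a0 \<beta> (fst p) (snd p)"
      using unique_solution assms by blast
  next
    fix a \<phi> :: "real \<Rightarrow> real" and t :: real
    assume "global_edgb_solution a0 \<beta> a \<phi>"
    then interpret reduced_flow \<beta> "hubble a" \<phi> "\<lambda>t. - deriv \<phi> t / hubble a t"
      using solution_reduced_flow assms by blast
    {
      assume t: "t < 0"
      show "hubble a t < min
          ((exp (6 * \<gamma> * t) * (1 / \<beta>^2 - 4 * \<beta> / (5 * \<gamma>) + 2 * \<theta> / (15 * \<gamma>^2))
             - 2 * (- 6 * \<beta> * \<gamma> + \<theta> + 6 * \<gamma> * \<theta> * t) / (15 * \<gamma>^2)) powr (- 1 / 2))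
          (\<gamma> / (- 3 * \<beta>^3 * t + 1))"
        using H_backward_upper[OF \<gamma> t \<theta>_pos \<theta>_le] H_less_\<gamma>_div[OF \<gamma>, of t] t
        unfolding u_def by simp
      show "hubble a t > (\<beta> powr (- 1 / 4) - \<beta> powr (- 1 / 4) / (4 * (m + 1))
             * (1 - (- 3 * \<beta>^3 * t + 1) powr (m + 1))) powi (- 4)"
        "(\<beta> powr (- 1 / 4) - \<beta> powr (- 1 / 4) / (4 * (m + 1))
             * (1 - (- 3 * \<beta>^3 * t + 1) powr (m + 1))) powi (- 4) > 0"
        using H_backward_lower[OF \<gamma> t m] unfolding u_def by blast+
      show "ln ((- 3 * \<beta>^3 * t + 1)^2) < \<phi> t"
        using \<phi>_backward_lower[OF t] unfolding u_def .
      show "\<phi> t < sqrt 6 * \<gamma> / (3 * \<beta>^3) * ln (- 3 * \<beta>^3 * t + 1)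
             + 2 * \<beta>^3 / (4 * \<gamma> + \<beta>^3)
               * ((- 3 * \<beta>^3 * t + 1) powr ((4 * \<gamma> + \<beta>^3) / \<beta>^3) - 1)"
        using \<phi>_backward_upper[OF \<gamma> t] unfolding u_def .
    next
      assume t: "0 < t"
      show "1 / (5 * t + 1 / \<beta>) < hubble a t" "hubble a t < 1 / (1 / 2 * t + 1 / \<beta>)"
        by (fact H_forward[OF t])+
      show "- (12 * \<beta>^2 + 2 * sqrt 6) * ln (1 / 2 * \<beta> * t + 1) < \<phi> t"
        by (fact \<phi>_forward_lower[OF t])
      show "\<phi> t < - ln (1 + 3 / 5 * (\<beta>^2 - 1 / (5 * t + 1 / \<beta>)^2))"
        by (fact \<phi>_forward_upper[OF t])
    }
  qed
qed

end
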